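(* Let $\mathcal G$ satisfy the self-adjointness identity $\int_\Omega \mathcal G(f)\,g\,dx=\int_\Omega f\,\mathcal G(g)\,dx$ for all $f,g\in L^\infty(\Omega)$ and the regularization property $\mathcal G: L^\infty(\Omega)\to\mathcal C(\overline\Omega)$. Then there exists an extension $$\mathcal G:\mathcal M(\Omega)\to L^1(\Omega)$$ which is linear and continuous. Furthermore, this extension is unique and self-adjoint. The function $u=\mathcal G(\mu)$ is the unique function such that $u\in L^1(\Omega)$ and $$\int_\Omega u\,\psi\,dx=\int_\Omega \mathcal G(\psi)\,d\mu\qquad \text{for all }\psi\in L^\infty_c(\Omega).$$
   Context: Setting: $n\ge 3$, $0<s\le 1$, $0<\gamma\le 1$, $\Omega\subset\mathbb R^n$ is a bounded domain, $\delta(x)=\mathrm{dist}(x,\partial\Omega)$. The Green operator is $\mathcal G(f)(x)=\int_\Omega \mathbb G(x,y)f(y)\,dy$, where the kernel $\mathbb G\ge 0$ on $\Omega\times\Omega$ satisfies: (G1) $\mathbb G(x,y)=\mathbb G(y,x)$; (G2) there are constants $0<c\le C$ with $c\,K(x,y)\le \mathbb G(x,y)\le C\,K(x,y)$, where $K(x,y)=\frac{1}{|x-y|^{n-2s}}\left(\min\left\{\frac{\delta(x)\delta(y)}{|x-y|^2},1\right\}\right)^\gamma$; (G3) $\int_\Omega f\,\mathcal G(f)\,dx\ge 0$ for all $f\in L^2(\Omega)$; (G4) $\mathcal G$ maps $L^\infty(\Omega)$ into $\mathcal C(\overline\Omega)$. $\mathcal M(\Omega)$ is the space of finite signed Radon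 measures on $\Omega$ with the total variation norm; functions $f\in L^1(\Omega)$ are identified with the measures $f\,dx$, and "extension" means extension of the operator $\mathcal G$ from functions to measures. For the extended operator, "self-adjoint" means $\int_\Omega \mathcal G(\mu)\,\psi\,dx=\int_\Omega \mathcal G(\psi)\,d\mu$ for all $\mu\in\mathcal M(\Omega)$ and $\psi\in L^\infty(\Omega)$. $L^\infty_c(\Omega)$ is the set of bounded measurable functions with compact support in $\Omega$.
   Formalization: Uniqueness of the extension is stated only among self-adjoint linear continuous extensions; without self-adjointness it fails, since adding μ({a})h with a in Ω and nonzero h in L¹(Ω) gives another linear continuous extension. *)

theory Defs
  imports "HOL-Analysis.Analysis"
begin

section \<open>Function spaces on a domain\<close>

definition bounded_domain :: "(real ^ 'n) set \<Rightarrow> bool" where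
  "bounded_domain \<Omega> \<longleftrightarrow> open \<Omega> \<and> connected \<Omega> \<and> \<Omega> \<noteq> {} \<and> bounded \<Omega>"

text \<open>
  Elements of the Lebesgue spaces are represented by functions; equality in them is equality
  almost everywhere on \<open>\<Omega>\<close>, which is written out where it is needed.
\<close>

definition L1 :: "(real ^ 'n) set \<Rightarrow> (real ^ 'n \<Rightarrow> real) set" where
  "L1 \<Omega> = {f. integrable (lebesgue_on \<Omega>) f}"

definition L2 :: "(real ^ 'n) set \<Rightarrow> (real ^ 'n \<Rightarrow> real) set" where
  "L2 \<Omega> = {f \<in> borel_measurable (lebesgue_on \<Omega>). integrable (lebesgue_on \<Omega>) (\<lambda>x. (f x)\<^sup>2)}"

definition Linf :: "(real ^ 'n) set \<Rightarrow> (real ^ 'n \<Rightarrow> real) set" where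
  "Linf \<Omega> = {f \<in> borel_measurable (lebesgue_on \<Omega>). \<exists>C. AE x in lebesgue_on \<Omega>. \<bar>f x\<bar> \<le> C}"

definition Linf_c :: "(real ^ 'n) set \<Rightarrow> (real ^ 'n \<Rightarrow> real) set" where
  "Linf_c \<Omega> = {f \<in> Linf \<Omega>. \<exists>K. compact K \<and> K \<subseteq> \<Omega> \<and> (AE x in lebesgue_on \<Omega>. x \<notin> K \<longrightarrow> f x = 0)}"

definition L1_norm :: "(real ^ 'n) set \<Rightarrow> (real ^ 'n \<Rightarrow> real) \<Rightarrow> real" where
  "L1_norm \<Omega> f = (LINT x|lebesgue_on \<Omega>. \<bar>f x\<bar>)"

section \<open>The Green operator\<close>

definition bdist :: "(real ^ 'n) set \<Rightarrow> real ^ 'n \<Rightarrow> real" where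
  "bdist \<Omega> x = infdist x (frontier \<Omega>)"

definition model_kernel :: "(real ^ 'n) set \<Rightarrow> real \<Rightarrow> real \<Rightarrow> real ^ 'n \<Rightarrow> real ^ 'n \<Rightarrow> real" where
  "model_kernel \<Omega> s \<gamma> x y =
     1 / norm (x - y) powr (real CARD('n) - 2 * s) *
     (min (bdist \<Omega> x * bdist \<Omega> y / (norm (x - y))\<^sup>2) 1) powr \<gamma>"

definition green_op ::
  "(real ^ 'n) set \<Rightarrow> (real ^ 'n \<Rightarrow> real ^ 'n \<Rightarrow> real) \<Rightarrow> (real ^ 'n \<Rightarrow> real) \<Rightarrow> real ^ 'n \<Rightarrow> real" where
  "green_op \<Omega> k f x = (LINT y|lebesgue_on \<Omega>. k x y * f y)"

text \<open>
  Joint Borel measurability makes all the integrals of the kernel, also those against measures,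
  meaningful. The two-sided bound is required off the diagonal only: on the diagonal the model
  kernel is infinite in the usual convention (and \<open>0\<close> in the convention \<open>1 / 0 = 0\<close>), while the real
  values of \<open>k\<close> there never matter, the diagonal sections being Lebesgue null sets.
\<close>

definition green_kernel ::
  "(real ^ 'n) set \<Rightarrow> real \<Rightarrow> real \<Rightarrow> (real ^ 'n \<Rightarrow> real ^ 'n \<Rightarrow> real) \<Rightarrow> bool" where
  "green_kernel \<Omega> s \<gamma> k \<longleftrightarrow>
     (\<lambda>(x, y). k x y) \<in> borel_measurable (restrict_space borel (\<Omega> \<times> \<Omega>)) \<and>
     (\<forall>x\<in>\<Omega>. \<forall>y\<in>\<Omega>. 0 \<le> k x y) \<and>
     (\<forall>x\<in>\<Omega>. \<forall>y\<in>\<Omega>. k x y = k y x) \<and>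
     (\<exists>c C. 0 < c \<and> c \<le> C \<and>
        (\<forall>x\<in>\<Omega>. \<forall>y\<in>\<Omega>. x \<noteq> y \<longrightarrow>
           c * model_kernel \<Omega> s \<gamma> x y \<le> k x y \<and> k x y \<le> C * model_kernel \<Omega> s \<gamma> x y)) \<and>
     (\<forall>f\<in>L2 \<Omega>. 0 \<le> (LINT x|lebesgue_on \<Omega>. f x * green_op \<Omega> k f x))"

definition green_self_adjoint :: "(real ^ 'n) set \<Rightarrow> (real ^ 'n \<Rightarrow> real ^ 'n \<Rightarrow> real) \<Rightarrow> bool" where
  "green_self_adjoint \<Omega> k \<longleftrightarrow>
     (\<forall>f\<in>Linf \<Omega>. \<forall>g\<in>Linf \<Omega>.
        (LINT x|lebesgue_on \<Omega>. green_op \<Omega> k f x * g x) =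
        (LINT x|lebesgue_on \<Omega>. f x * green_op \<Omega> k g x))"

definition green_regularizing :: "(real ^ 'n) set \<Rightarrow> (real ^ 'n \<Rightarrow> real ^ 'n \<Rightarrow> real) \<Rightarrow> bool" where
  "green_regularizing \<Omega> k \<longleftrightarrow>
     (\<forall>f\<in>Linf \<Omega>. \<exists>h. continuous_on (closure \<Omega>) h \<and> (\<forall>x\<in>\<Omega>. h x = green_op \<Omega> k f x))"

section \<open>Finite signed Radon measures\<close>

text \<open>
  A signed measure on \<open>\<Omega>\<close> is a real set function on the Borel subsets of \<open>\<Omega>\<close>. Its upper variation
  is the positive part of the Jordan decomposition, and the upper variation of \<open>-\<mu>\<close> the negative
  part. In \<open>upper_variation\<close>, \<open>ennreal\<close> truncates negative values to \<open>0 = \<mu> {}\<close>.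
\<close>

definition upper_variation ::
  "(real ^ 'n) set \<Rightarrow> ((real ^ 'n) set \<Rightarrow> real) \<Rightarrow> (real ^ 'n) set \<Rightarrow> ennreal" where
  "upper_variation \<Omega> \<mu> A = (SUP B\<in>{B \<in> sets (restrict_space borel \<Omega>). B \<subseteq> A}. ennreal (\<mu> B))"

definition total_variation ::
  "(real ^ 'n) set \<Rightarrow> ((real ^ 'n) set \<Rightarrow> real) \<Rightarrow> (real ^ 'n) set \<Rightarrow> ennreal" where
  "total_variation \<Omega> \<mu> A = upper_variation \<Omega> \<mu> A + upper_variation \<Omega> (\<lambda>B. - \<mu> B) A"

text \<open>
  Set functions are normalized to \<open>0\<close> outside the Borel subsets of \<open>\<Omega>\<close>, so that equality of signed
  measures is equality of functions.
\<close>

definition radon_measures :: "(real ^ 'n) set \<Rightarrow> ((real ^ 'n) set \<Rightarrow> real) set" where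
  "radon_measures \<Omega> = {\<mu>.
     (\<forall>A. A \<notin> sets (restrict_space borel \<Omega>) \<longrightarrow> \<mu> A = 0) \<and>
     (\<forall>A :: nat \<Rightarrow> (real ^ 'n) set.
        range A \<subseteq> sets (restrict_space borel \<Omega>) \<and> disjoint_family A \<longrightarrow>
        (\<lambda>i. \<mu> (A i)) sums \<mu> (\<Union>i. A i)) \<and>
     total_variation \<Omega> \<mu> \<Omega> < \<infinity> \<and>
     (\<forall>A \<in> sets (restrict_space borel \<Omega>). \<forall>e > 0.
        \<exists>K. compact K \<and> K \<subseteq> A \<and> total_variation \<Omega> \<mu> (A - K) < ennreal e)}"

definition upper_measure :: "(real ^ 'n) set \<Rightarrow> ((real ^ 'n) set \<Rightarrow> real) \<Rightarrow> (real ^ 'n) measure" where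
  "upper_measure \<Omega> \<mu> = measure_of \<Omega> (sets (restrict_space borel \<Omega>)) (upper_variation \<Omega> \<mu>)"

definition signed_integral ::
  "(real ^ 'n) set \<Rightarrow> ((real ^ 'n) set \<Rightarrow> real) \<Rightarrow> (real ^ 'n \<Rightarrow> real) \<Rightarrow> real" where
  "signed_integral \<Omega> \<mu> \<phi> =
     (LINT x|upper_measure \<Omega> \<mu>. \<phi> x) - (LINT x|upper_measure \<Omega> (\<lambda>B. - \<mu> B). \<phi> x)"

definition density_measure ::
  "(real ^ 'n) set \<Rightarrow> (real ^ 'n \<Rightarrow> real) \<Rightarrow> (real ^ 'n) set \<Rightarrow> real" where
  "density_measure \<Omega> f A =
     (if A \<in> sets (restrict_space borel \<Omega>) then (LINT x|lebesgue_on A. f x) else 0)"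

section \<open>Extensions of the Green operator to measures\<close>

definition maps_into_L1 ::
  "(real ^ 'n) set \<Rightarrow> (((real ^ 'n) set \<Rightarrow> real) \<Rightarrow> real ^ 'n \<Rightarrow> real) \<Rightarrow> bool" where
  "maps_into_L1 \<Omega> T \<longleftrightarrow> (\<forall>\<mu>\<in>radon_measures \<Omega>. T \<mu> \<in> L1 \<Omega>)"

definition linear_on_measures ::
  "(real ^ 'n) set \<Rightarrow> (((real ^ 'n) set \<Rightarrow> real) \<Rightarrow> real ^ 'n \<Rightarrow> real) \<Rightarrow> bool" where
  "linear_on_measures \<Omega> T \<longleftrightarrow>
     (\<forall>\<mu>\<in>radon_measures \<Omega>. \<forall>\<nu>\<in>radon_measures \<Omega>. \<forall>a b.
        AE x in lebesgue_on \<Omega>. T (\<lambda>A. a * \<mu> A + b * \<nu> A) x = a * T \<mu> x + b * T \<nu> x)"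

definition continuous_on_measures ::
  "(real ^ 'n) set \<Rightarrow> (((real ^ 'n) set \<Rightarrow> real) \<Rightarrow> real ^ 'n \<Rightarrow> real) \<Rightarrow> bool" where
  "continuous_on_measures \<Omega> T \<longleftrightarrow>
     (\<forall>\<mu>\<in>radon_measures \<Omega>. \<forall>e>0. \<exists>d>0. \<forall>\<nu>\<in>radon_measures \<Omega>.
        total_variation \<Omega> (\<lambda>A. \<nu> A - \<mu> A) \<Omega> < ennreal d \<longrightarrow>
        L1_norm \<Omega> (\<lambda>x. T \<nu> x - T \<mu> x) < e)"

definition extends_green_op ::
  "(real ^ 'n) set \<Rightarrow> (real ^ 'n \<Rightarrow> real ^ 'n \<Rightarrow> real) \<Rightarrow>
   (((real ^ 'n) set \<Rightarrow> real) \<Rightarrow> real ^ 'n \<Rightarrow> real) \<Rightarrow> bool" where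
  "extends_green_op \<Omega> k T \<longleftrightarrow>
     (\<forall>f\<in>L1 \<Omega>. AE x in lebesgue_on \<Omega>. T (density_measure \<Omega> f) x = green_op \<Omega> k f x)"

definition continuous_linear_extension ::
  "(real ^ 'n) set \<Rightarrow> (real ^ 'n \<Rightarrow> real ^ 'n \<Rightarrow> real) \<Rightarrow>
   (((real ^ 'n) set \<Rightarrow> real) \<Rightarrow> real ^ 'n \<Rightarrow> real) \<Rightarrow> bool" where
  "continuous_linear_extension \<Omega> k T \<longleftrightarrow>
     maps_into_L1 \<Omega> T \<and> extends_green_op \<Omega> k T \<and>
     linear_on_measures \<Omega> T \<and> continuous_on_measures \<Omega> T"

text \<open>
  Integrable functions are not dense in the measures for the total variation norm: adding
  \<open>\<mu> {a} * h x\<close> with fixed \<open>a\<close> in \<open>\<Omega>\<close> and \<open>h\<close> in \<open>L1 \<Omega>\<close> gives another continuous linear extension.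
  Uniqueness of the extension therefore means uniqueness among the self-adjoint ones.
\<close>

definition self_adjoint_extension ::
  "(real ^ 'n) set \<Rightarrow> (real ^ 'n \<Rightarrow> real ^ 'n \<Rightarrow> real) \<Rightarrow>
   (((real ^ 'n) set \<Rightarrow> real) \<Rightarrow> real ^ 'n \<Rightarrow> real) \<Rightarrow> bool" where
  "self_adjoint_extension \<Omega> k T \<longleftrightarrow>
     (\<forall>\<mu>\<in>radon_measures \<Omega>. \<forall>\<psi>\<in>Linf \<Omega>.
        (LINT x|lebesgue_on \<Omega>. T \<mu> x * \<psi> x) = signed_integral \<Omega> \<mu> (green_op \<Omega> k \<psi>))"

definition weak_dual_solution ::
  "(real ^ 'n) set \<Rightarrow> (real ^ 'n \<Rightarrow> real ^ 'n \<Rightarrow> real) \<Rightarrow>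
   ((real ^ 'n) set \<Rightarrow> real) \<Rightarrow> (real ^ 'n \<Rightarrow> real) \<Rightarrow> bool" where
  "weak_dual_solution \<Omega> k \<mu> u \<longleftrightarrow>
     u \<in> L1 \<Omega> \<and>
     (\<forall>\<psi>\<in>Linf_c \<Omega>.
        (LINT x|lebesgue_on \<Omega>. u x * \<psi> x) = signed_integral \<Omega> \<mu> (green_op \<Omega> k \<psi>))"

end

theory Submission
  imports Defs
begin

text \<open>
  The extension is the potential \<open>T \<mu> x = \<integral> k x y d\<mu>(y)\<close>, integrated against the Jordan
  decomposition of \<open>\<mu>\<close>. Everything rests on one estimate (\<open>green_kernel_mass_bounded\<close>): off the
  diagonal \<open>k x y\<close> is at most a multiple of \<open>\<bar>x - y\<bar> powr (2 s - n)\<close>, a power which is integrable over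
  balls because \<open>n - 2 s < n\<close>, so the masses \<open>\<integral> k x y dx\<close> are bounded by a constant \<open>M\<close>
  uniformly in \<open>y \<in> \<Omega>\<close>. By Tonelli \<open>k\<close> is then integrable for the product of Lebesgue
  measure with any finite measure \<open>P\<close> on \<open>\<Omega>\<close>, with integral at most \<open>M * P(\<Omega>)\<close>. Hence the
  potential of \<open>P\<close> is finite almost everywhere and integrable, its \<open>L1\<close> norm is controlled by
  the mass of \<open>P\<close>, and Fubini together with the symmetry of \<open>k\<close> gives
  \<open>\<integral> T P \<psi> dx = \<integral> G \<psi> dP\<close> for bounded \<open>\<psi>\<close> (\<open>integral_potential_mult\<close>).

  It remains to pass to signed measures. The upper variations of \<open>\<mu>\<close> and \<open>-\<mu>\<close> are finite
  measures with difference \<open>\<mu>\<close> (\<open>jordan_decomposition\<close>), but they depend neither linearly on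
  \<open>\<mu>\<close> nor, for \<open>\<mu> = f dx\<close>, transparently on \<open>f\<close>. Both difficulties disappear with the remark that a
  linear relation between finite measures is inherited by the integrals of every function that is
  integrable for all of them (\<open>integral_linear_relation\<close>): almost every kernel section is such
  a function, so \<open>T\<close> is linear almost everywhere and agrees with the Green operator on
  densities. Continuity follows from linearity and the \<open>L1\<close> bound applied to \<open>\<nu> - \<mu>\<close>.

  For uniqueness, two weak dual solutions \<open>u\<close> and \<open>v\<close> have the same integrals against bounded
  functions of compact support; testing with the sign of \<open>u - v\<close> cut off to a compact set
  gives \<open>u = v\<close> almost everywhere. Any self-adjoint extension produces weak dual solutions, so it is
  unique as well.
\<close>

section \<open>Finite signed measures and their variations\<close>

abbreviation borel_of :: "(real ^ 'n) set \<Rightarrow> (real ^ 'n) measure" where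
  "borel_of \<Omega> \<equiv> restrict_space borel \<Omega>"

lemma borel_of_subset: "A \<in> sets (borel_of \<Omega>) \<Longrightarrow> A \<subseteq> \<Omega>"
  by (auto dest!: sets.sets_into_space simp: space_restrict_space)

lemma domain_in_borel_of: "\<Omega> \<in> sets (borel_of \<Omega>)"
  using sets.top[of "borel_of \<Omega>"] by (simp add: space_restrict_space)

definition sigma_additive :: "(real ^ 'n) set \<Rightarrow> ((real ^ 'n) set \<Rightarrow> real) \<Rightarrow> bool" where
  "sigma_additive \<Omega> \<mu> \<longleftrightarrow>
     (\<forall>A :: nat \<Rightarrow> (real ^ 'n) set. range A \<subseteq> sets (borel_of \<Omega>) \<and> disjoint_family A \<longrightarrow>
        (\<lambda>i. \<mu> (A i)) sums \<mu> (\<Union>i. A i))"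

text \<open>
  Boundedness rather than finite total variation makes the closure under linear combinations
  immediate; the finiteness of the variations is recovered in \<open>finite_upper_measure\<close>.
\<close>
definition finite_signed_measure :: "(real ^ 'n) set \<Rightarrow> ((real ^ 'n) set \<Rightarrow> real) \<Rightarrow> bool" where
  "finite_signed_measure \<Omega> \<mu> \<longleftrightarrow>
     sigma_additive \<Omega> \<mu> \<and> (\<exists>C. \<forall>B\<in>sets (borel_of \<Omega>). \<bar>\<mu> B\<bar> \<le> C)"

lemma sigma_additive_empty:
  assumes "sigma_additive \<Omega> \<mu>"
  shows "\<mu> {} = 0"
proof -
  have "(\<lambda>i::nat. \<mu> {}) sums \<mu> (\<Union>i::nat. {})"
    using assms unfolding sigma_additive_def
    by (elim allE[of _ "\<lambda>_. {}"]) (auto simp: disjoint_family_on_def)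
  then show ?thesis
    using summable_const_iff[of "\<mu> {}"] sums_summable by blast
qed

lemma sigma_additive_Un:
  assumes "sigma_additive \<Omega> \<mu>" "A \<in> sets (borel_of \<Omega>)" "B \<in> sets (borel_of \<Omega>)" "A \<inter> B = {}"
  shows "\<mu> (A \<union> B) = \<mu> A + \<mu> B"
proof -
  have "range (binaryset A B) \<subseteq> sets (borel_of \<Omega>)" "disjoint_family (binaryset A B)"
    using assms by (auto simp: range_binaryset_eq disjoint_family_on_def binaryset_def)
  then have "(\<lambda>i. \<mu> (binaryset A B i)) sums \<mu> (\<Union>i. binaryset A B i)"
    using assms(1) unfolding sigma_additive_def by blast
  moreover have "(\<lambda>i. \<mu> (binaryset A B i)) sums (\<mu> A + \<mu> B)"
    by (rule binaryset_sums) (rule sigma_additive_empty[OF assms(1)])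
  ultimately show ?thesis
    by (metis UN_binaryset_eq sums_unique2)
qed

lemma sigma_additive_linear_combination:
  assumes "sigma_additive \<Omega> \<mu>" "sigma_additive \<Omega> \<nu>"
  shows "sigma_additive \<Omega> (\<lambda>A. a * \<mu> A + b * \<nu> A)"
  using assms unfolding sigma_additive_def by (auto intro!: sums_add sums_mult)

lemma finite_signed_measure_linear_combination:
  assumes "finite_signed_measure \<Omega> \<mu>" "finite_signed_measure \<Omega> \<nu>"
  shows "finite_signed_measure \<Omega> (\<lambda>A. a * \<mu> A + b * \<nu> A)"
proof -
  obtain C D where C: "\<And>B. B \<in> sets (borel_of \<Omega>) \<Longrightarrow> \<bar>\<mu> B\<bar> \<le> C"
    and D: "\<And>B. B \<in> sets (borel_of \<Omega>) \<Longrightarrow> \<bar>\<nu> B\<bar> \<le> D"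
    using assms unfolding finite_signed_measure_def by blast
  have "\<bar>a * \<mu> B + b * \<nu> B\<bar> \<le> \<bar>a\<bar> * C + \<bar>b\<bar> * D" if "B \<in> sets (borel_of \<Omega>)" for B
    by (rule order_trans[OF abs_triangle_ineq])
       (auto simp: abs_mult intro!: add_mono mult_left_mono C D that)
  then show ?thesis
    using assms sigma_additive_linear_combination unfolding finite_signed_measure_def by blast
qed

lemma finite_signed_measure_uminus:
  assumes "finite_signed_measure \<Omega> \<mu>"
  shows "finite_signed_measure \<Omega> (\<lambda>A. - \<mu> A)"
  using finite_signed_measure_linear_combination[OF assms assms, of "-1" 0] by simp

text \<open>
  Truncation of negative terms to \<open>0\<close> can only increase the partial sums.
\<close>
lemma ennreal_sums_le:
  assumes "a sums s"
  shows "ennreal s \<le> (\<Sum>i. ennreal (a i))"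
proof (rule LIMSEQ_le_const2)
  show "(\<lambda>n. ennreal (\<Sum>i<n. a i)) \<longlonglongrightarrow> ennreal s"
    using assms unfolding sums_def by (rule tendsto_ennrealI)
  have "ennreal (\<Sum>i\<in>I. a i) \<le> (\<Sum>i\<in>I. ennreal (a i))" if "finite I" for I
    using that
  proof induction
    case (insert i I)
    have "ennreal (a i + (\<Sum>i\<in>I. a i)) \<le> ennreal (a i) + ennreal (\<Sum>i\<in>I. a i)"
      by (cases "a i \<ge> 0"; cases "(\<Sum>i\<in>I. a i) \<ge> 0")
         (auto simp: ennreal_plus ennreal_neg intro!: ennreal_leI)
    with insert show ?case
      by (auto intro: order_trans add_left_mono)
  qed simp
  then have "ennreal (\<Sum>i<n. a i) \<le> (\<Sum>i. ennreal (a i))" for n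
    by (rule order_trans[OF _ sum_le_suminf]) auto
  then show "\<exists>N. \<forall>n\<ge>N. ennreal (\<Sum>i<n. a i) \<le> (\<Sum>i. ennreal (a i))" by blast
qed

lemma upper_variation_mono:
  "A \<subseteq> A' \<Longrightarrow> upper_variation \<Omega> \<mu> A \<le> upper_variation \<Omega> \<mu> A'"
  unfolding upper_variation_def by (intro SUP_subset_mono) auto

lemma upper_variation_upper:
  "B \<in> sets (borel_of \<Omega>) \<Longrightarrow> B \<subseteq> A \<Longrightarrow> ennreal (\<mu> B) \<le> upper_variation \<Omega> \<mu> A"
  unfolding upper_variation_def by (intro SUP_upper) auto

text \<open>
  Competitors for \<open>A\<close> and \<open>A'\<close> can be glued when both have nonnegative measure; otherwise one of
  them contributes \<open>0\<close> to the sum and the other alone is a competitor for the union.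
\<close>
lemma upper_variation_superadditive:
  assumes "sigma_additive \<Omega> \<mu>" "A \<inter> A' = {}"
  shows "upper_variation \<Omega> \<mu> A + upper_variation \<Omega> \<mu> A' \<le> upper_variation \<Omega> \<mu> (A \<union> A')"
proof -
  let ?S = "\<lambda>A. {B \<in> sets (borel_of \<Omega>). B \<subseteq> A}"
  have ne: "?S X \<noteq> {}" for X by auto
  have "ennreal (\<mu> B) + ennreal (\<mu> B') \<le> upper_variation \<Omega> \<mu> (A \<union> A')"
    if B: "B \<in> ?S A" and B': "B' \<in> ?S A'" for B B'
  proof (cases "\<mu> B \<ge> 0 \<and> \<mu> B' \<ge> 0")
    case True
    have "\<mu> (B \<union> B') = \<mu> B + \<mu> B'"
      using B B' assms(2) by (intro sigma_additive_Un[OF assms(1)]) auto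
    with True have "ennreal (\<mu> B) + ennreal (\<mu> B') = ennreal (\<mu> (B \<union> B'))"
      by (simp add: ennreal_plus)
    also have "\<dots> \<le> upper_variation \<Omega> \<mu> (A \<union> A')"
      using B B' by (intro upper_variation_upper) auto
    finally show ?thesis .
  next
    case False
    moreover have "ennreal (\<mu> B) \<le> upper_variation \<Omega> \<mu> (A \<union> A')"
      "ennreal (\<mu> B') \<le> upper_variation \<Omega> \<mu> (A \<union> A')"
      using B B' by (auto intro!: upper_variation_upper)
    ultimately show ?thesis
      by (auto simp: ennreal_neg not_le)
  qed
  then have "(SUP B\<in>?S A. SUP B'\<in>?S A'. ennreal (\<mu> B) + ennreal (\<mu> B')) \<le> upper_variation \<Omega> \<mu> (A \<union> A')"
    by (intro SUP_least)
  also have "(SUP B\<in>?S A. SUP B'\<in>?S A'. ennreal (\<mu> B) + ennreal (\<mu> B'))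
      = (SUP B\<in>?S A. ennreal (\<mu> B) + upper_variation \<Omega> \<mu> A')"
    unfolding upper_variation_def by (intro SUP_cong refl ennreal_SUP_add_right[symmetric] ne)
  also have "\<dots> = upper_variation \<Omega> \<mu> A + upper_variation \<Omega> \<mu> A'"
    unfolding upper_variation_def[of _ _ A] by (rule ennreal_SUP_add_left[OF ne])
  finally show ?thesis .
qed

text \<open>
  Subadditivity comes from splitting a competitor along the partition, superadditivity from
  gluing competitors; only finite gluing is needed because series of nonnegative terms are
  suprema of their partial sums.
\<close>
lemma countably_additive_upper_variation:
  fixes \<Omega> :: "(real ^ 'n) set"
  assumes "sigma_additive \<Omega> \<mu>"
  shows "countably_additive (sets (borel_of \<Omega>)) (upper_variation \<Omega> \<mu>)"
proof (rule countably_additiveI)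
  fix A :: "nat \<Rightarrow> (real ^ 'n) set"
  assume A: "range A \<subseteq> sets (borel_of \<Omega>)" and disj: "disjoint_family A"
  show "(\<Sum>i. upper_variation \<Omega> \<mu> (A i)) = upper_variation \<Omega> \<mu> (\<Union>i. A i)"
  proof (rule antisym)
    have "(\<Sum>i<n. upper_variation \<Omega> \<mu> (A i)) \<le> upper_variation \<Omega> \<mu> (\<Union>i. A i)" for n
    proof (rule order_trans)
      show "(\<Sum>i<n. upper_variation \<Omega> \<mu> (A i)) \<le> upper_variation \<Omega> \<mu> (\<Union>i<n. A i)"
      proof (induction n)
        case (Suc n)
        have "(\<Union>i<n. A i) \<inter> A n = {}"
          using disj unfolding disjoint_family_on_def
          by (metis (no_types, lifting) UNIV_I disjoint_iff UN_iff less_irrefl lessThan_iff)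
        then have "upper_variation \<Omega> \<mu> (\<Union>i<n. A i) + upper_variation \<Omega> \<mu> (A n)
                   \<le> upper_variation \<Omega> \<mu> ((\<Union>i<n. A i) \<union> A n)"
          by (rule upper_variation_superadditive[OF assms])
        moreover have "(\<Union>i<n. A i) \<union> A n = (\<Union>i<Suc n. A i)"
          by (auto simp: less_Suc_eq)
        ultimately have "upper_variation \<Omega> \<mu> (\<Union>i<n. A i) + upper_variation \<Omega> \<mu> (A n)
                   \<le> upper_variation \<Omega> \<mu> (\<Union>i<Suc n. A i)" by metis
        with add_right_mono[OF Suc, of "upper_variation \<Omega> \<mu> (A n)"] show ?case
          unfolding sum.lessThan_Suc by (rule order_trans)
      qed simp
      show "upper_variation \<Omega> \<mu> (\<Union>i<n. A i) \<le> upper_variation \<Omega> \<mu> (\<Union>i. A i)"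
        by (rule upper_variation_mono) auto
    qed
    then show "(\<Sum>i. upper_variation \<Omega> \<mu> (A i)) \<le> upper_variation \<Omega> \<mu> (\<Union>i. A i)"
      by (intro suminf_le_const) auto
    show "upper_variation \<Omega> \<mu> (\<Union>i. A i) \<le> (\<Sum>i. upper_variation \<Omega> \<mu> (A i))"
      unfolding upper_variation_def[of _ _ "\<Union>i. A i"]
    proof (rule SUP_least)
      fix B assume B: "B \<in> {B \<in> sets (borel_of \<Omega>). B \<subseteq> (\<Union>i. A i)}"
      have "range (\<lambda>i. B \<inter> A i) \<subseteq> sets (borel_of \<Omega>)"
        using A B by auto
      moreover have "disjoint_family (\<lambda>i. B \<inter> A i)"
        using disj unfolding disjoint_family_on_def by blast
      ultimately have "(\<lambda>i. \<mu> (B \<inter> A i)) sums \<mu> (\<Union>i. B \<inter> A i)"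
        using assms unfolding sigma_additive_def by (elim allE[of _ "\<lambda>i. B \<inter> A i"]) blast
      moreover have "(\<Union>i. B \<inter> A i) = B" using B by auto
      ultimately have "ennreal (\<mu> B) \<le> (\<Sum>i. ennreal (\<mu> (B \<inter> A i)))"
        using ennreal_sums_le by metis
      also have "\<dots> \<le> (\<Sum>i. upper_variation \<Omega> \<mu> (A i))"
        using A B by (intro suminf_le upper_variation_upper) auto
      finally show "ennreal (\<mu> B) \<le> (\<Sum>i. upper_variation \<Omega> \<mu> (A i))" .
    qed
  qed
qed

lemma sets_upper_measure [simp, measurable_cong]:
  "sets (upper_measure \<Omega> \<mu>) = sets (borel_of \<Omega>)"
  using sets.sigma_sets_eq[of "borel_of \<Omega>"] sets.space_closed[of "borel_of \<Omega>"]
  unfolding upper_measure_def by (simp add: space_restrict_space)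

lemma space_upper_measure [simp]: "space (upper_measure \<Omega> \<mu>) = \<Omega>"
  unfolding upper_measure_def using sets.space_closed[of "borel_of \<Omega>"]
  by (simp add: space_restrict_space)

lemma emeasure_upper_measure:
  assumes "sigma_additive \<Omega> \<mu>" "A \<in> sets (borel_of \<Omega>)"
  shows "emeasure (upper_measure \<Omega> \<mu>) A = upper_variation \<Omega> \<mu> A"
  unfolding upper_measure_def
proof (rule emeasure_measure_of_sigma)
  show "sigma_algebra \<Omega> (sets (borel_of \<Omega>))"
    using sets.sigma_algebra_axioms[of "borel_of \<Omega>"] by (simp add: space_restrict_space)
  have "upper_variation \<Omega> \<mu> {} = 0"
    using sigma_additive_empty[OF assms(1)] by (auto simp: upper_variation_def intro!: SUP_eqI)
  then show "positive (sets (borel_of \<Omega>)) (upper_variation \<Omega> \<mu>)"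
    by (simp add: positive_def)
qed (use assms countably_additive_upper_variation in auto)

lemma finite_upper_measure:
  assumes "finite_signed_measure \<Omega> \<mu>"
  shows "finite_measure (upper_measure \<Omega> \<mu>)"
proof
  obtain C where "\<And>B. B \<in> sets (borel_of \<Omega>) \<Longrightarrow> \<bar>\<mu> B\<bar> \<le> C"
    using assms unfolding finite_signed_measure_def by blast
  then have "upper_variation \<Omega> \<mu> \<Omega> \<le> ennreal C"
    unfolding upper_variation_def by (intro SUP_least ennreal_leI) (auto dest: abs_le_D1)
  then show "emeasure (upper_measure \<Omega> \<mu>) (space (upper_measure \<Omega> \<mu>)) \<noteq> \<infinity>"
    using assms domain_in_borel_of[of \<Omega>]
    by (auto simp: emeasure_upper_measure finite_signed_measure_def top_unique)
qed

text \<open>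
  For \<open>B \<subseteq> A\<close> one has \<open>\<mu> B = \<mu> A + (- \<mu> (A - B))\<close>; taking suprema over \<open>B\<close> gives the Jordan
  decomposition without a Hahn decomposition of the space.
\<close>
lemma jordan_decomposition:
  assumes \<mu>: "finite_signed_measure \<Omega> \<mu>" and A: "A \<in> sets (borel_of \<Omega>)"
  shows "\<mu> A = measure (upper_measure \<Omega> \<mu>) A - measure (upper_measure \<Omega> (\<lambda>B. - \<mu> B)) A"
proof -
  have le: "measure (upper_measure \<Omega> \<nu>) A \<le> \<nu> A + measure (upper_measure \<Omega> (\<lambda>B. - \<nu> B)) A"
    if \<nu>: "finite_signed_measure \<Omega> \<nu>" for \<nu>
  proof -
    interpret P: finite_measure "upper_measure \<Omega> \<nu>"
      by (rule finite_upper_measure[OF \<nu>])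
    interpret N: finite_measure "upper_measure \<Omega> (\<lambda>B. - \<nu> B)"
      by (rule finite_upper_measure[OF finite_signed_measure_uminus[OF \<nu>]])
    have sa: "sigma_additive \<Omega> \<nu>" "sigma_additive \<Omega> (\<lambda>B. - \<nu> B)"
      using \<nu> finite_signed_measure_uminus[OF \<nu>] unfolding finite_signed_measure_def by auto
    have "\<nu> B \<le> \<nu> A + measure (upper_measure \<Omega> (\<lambda>B. - \<nu> B)) A"
      if B: "B \<in> sets (borel_of \<Omega>)" "B \<subseteq> A" for B
    proof -
      have "ennreal (- \<nu> (A - B)) \<le> emeasure (upper_measure \<Omega> (\<lambda>B. - \<nu> B)) A"
        using A B upper_variation_upper[of "A - B" \<Omega> A "\<lambda>B. - \<nu> B"]
        by (auto simp: emeasure_upper_measure sa)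
      then have "- \<nu> (A - B) \<le> measure (upper_measure \<Omega> (\<lambda>B. - \<nu> B)) A"
        unfolding N.emeasure_eq_measure by (subst (asm) ennreal_le_iff) auto
      moreover have "\<nu> (B \<union> (A - B)) = \<nu> B + \<nu> (A - B)"
        using A B by (intro sigma_additive_Un[OF sa(1)]) auto
      moreover have "B \<union> (A - B) = A" using B by auto
      ultimately show ?thesis by simp
    qed
    note * = this
    have "emeasure (upper_measure \<Omega> \<nu>) A
          \<le> ennreal (\<nu> A + measure (upper_measure \<Omega> (\<lambda>B. - \<nu> B)) A)"
      unfolding emeasure_upper_measure[OF sa(1) A] upper_variation_def
      by (intro SUP_least ennreal_leI *) auto
    moreover have "0 \<le> \<nu> A + measure (upper_measure \<Omega> (\<lambda>B. - \<nu> B)) A"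
      using *[of "{}"] sigma_additive_empty[OF sa(1)] by simp
    ultimately show ?thesis
      unfolding P.emeasure_eq_measure by (subst (asm) ennreal_le_iff) auto
  qed
  show ?thesis
    using le[OF \<mu>] le[OF finite_signed_measure_uminus[OF \<mu>]] by simp
qed

lemma radon_measures_finite_signed_measure:
  assumes "\<mu> \<in> radon_measures \<Omega>"
  shows "finite_signed_measure \<Omega> \<mu>"
proof -
  have sa: "sigma_additive \<Omega> \<mu>" and tv: "total_variation \<Omega> \<mu> \<Omega> < \<infinity>"
    using assms unfolding radon_measures_def sigma_additive_def by auto
  have "\<bar>\<mu> B\<bar> \<le> enn2real (total_variation \<Omega> \<mu> \<Omega>)" if B: "B \<in> sets (borel_of \<Omega>)" for B
  proof -
    have "ennreal (\<mu> B) \<le> total_variation \<Omega> \<mu> \<Omega>" "ennreal (- \<mu> B) \<le> total_variation \<Omega> \<mu> \<Omega>"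
      unfolding total_variation_def
      using upper_variation_upper[OF B borel_of_subset[OF B], of \<mu>]
        upper_variation_upper[OF B borel_of_subset[OF B], of "\<lambda>B. - \<mu> B"]
      by (auto intro: add_increasing add_increasing2)
    then have "ennreal \<bar>\<mu> B\<bar> \<le> total_variation \<Omega> \<mu> \<Omega>"
      by (auto simp: abs_if)
    also have "\<dots> = ennreal (enn2real (total_variation \<Omega> \<mu> \<Omega>))"
      using tv by simp
    finally show ?thesis by (subst (asm) ennreal_le_iff) auto
  qed
  with sa show ?thesis unfolding finite_signed_measure_def by blast
qed

section \<open>Linear relations between finite measures\<close>

text \<open>
  Simple functions satisfy the relation by rearranging their level sets, and one sequence of
  simple functions converges to \<open>f\<close> dominatedly for all the measures at once.
\<close>
lemma integral_linear_relation:
  fixes f :: "'a \<Rightarrow> real" and P :: "'i \<Rightarrow> 'a measure"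
  assumes fin: "finite I" and P: "\<And>i. i \<in> I \<Longrightarrow> finite_measure (P i)"
    and sets: "\<And>i. i \<in> I \<Longrightarrow> sets (P i) = sets S"
    and rel: "\<And>A. A \<in> sets S \<Longrightarrow> (\<Sum>i\<in>I. c i * measure (P i) A) = 0"
    and int: "\<And>i. i \<in> I \<Longrightarrow> integrable (P i) f" and f: "f \<in> borel_measurable S"
  shows "(\<Sum>i\<in>I. c i * integral\<^sup>L (P i) f) = 0"
proof -
  obtain F where F: "\<And>n. simple_function S (F n)"
    and lim: "\<And>x. x \<in> space S \<Longrightarrow> (\<lambda>n. F n x) \<longlonglongrightarrow> f x"
    and bound: "\<And>n x. x \<in> space S \<Longrightarrow> norm (F n x) \<le> 2 * norm (f x)"
    using borel_measurable_implies_sequence_metric[OF f, of 0] unfolding dist_0_norm dist_commute[of _ 0]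
    by blast
  have space: "space (P i) = space S" if "i \<in> I" for i
    using sets[OF that] by (rule sets_eq_imp_space_eq)
  have level: "{x \<in> space S. F n x = y} \<in> sets S" for n y
    using borel_measurable_simple_function[OF F] by measurable
  have simple: "integral\<^sup>L (P i) (F n) = (\<Sum>y\<in>F n ` space S. measure (P i) {x \<in> space S. F n x = y} * y)"
    if i: "i \<in> I" for i n
  proof -
    interpret finite_measure "P i" by (rule P[OF i])
    have "simple_function (P i) (F n)"
      using F simple_function_cong_algebra[OF sets[OF i] space[OF i]] by blast
    then have "Bochner_Integration.simple_bochner_integrable (P i) (F n)"
      unfolding simple_bochner_integrable.simps by simp
    from simple_bochner_integrable_eq_integral[OF this] show ?thesis
      by (simp add: simple_bochner_integral_def space[OF i])
  qed
  have zero: "(\<Sum>i\<in>I. c i * integral\<^sup>L (P i) (F n)) = 0" for n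
  proof -
    have "(\<Sum>i\<in>I. c i * integral\<^sup>L (P i) (F n))
          = (\<Sum>i\<in>I. \<Sum>y\<in>F n ` space S. y * (c i * measure (P i) {x \<in> space S. F n x = y}))"
      by (auto intro!: sum.cong simp: simple sum_distrib_left mult_ac)
    also have "\<dots> = (\<Sum>y\<in>F n ` space S. y * (\<Sum>i\<in>I. c i * measure (P i) {x \<in> space S. F n x = y}))"
      by (subst sum.swap) (simp add: sum_distrib_left)
    also have "\<dots> = 0" by (simp add: rel[OF level])
    finally show ?thesis .
  qed
  have "(\<lambda>n. integral\<^sup>L (P i) (F n)) \<longlonglongrightarrow> integral\<^sup>L (P i) f" if i: "i \<in> I" for i
  proof (rule integral_dominated_convergence[where w = "\<lambda>x. 2 * norm (f x)"])
    show "f \<in> borel_measurable (P i)" "F n \<in> borel_measurable (P i)" for n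
      using f borel_measurable_simple_function[OF F] measurable_cong_sets[OF sets[OF i] refl] by blast+
    show "integrable (P i) (\<lambda>x. 2 * norm (f x))" using int[OF i] by simp
    show "AE x in P i. (\<lambda>n. F n x) \<longlonglongrightarrow> f x" using lim by (auto simp: space[OF i])
    show "AE x in P i. norm (F n x) \<le> 2 * norm (f x)" for n
      using bound by (intro AE_I2) (simp add: space[OF i])
  qed
  then have "(\<lambda>n. \<Sum>i\<in>I. c i * integral\<^sup>L (P i) (F n)) \<longlonglongrightarrow> (\<Sum>i\<in>I. c i * integral\<^sup>L (P i) f)"
    by (intro tendsto_intros)
  then show ?thesis
    unfolding zero by (simp add: LIMSEQ_const_iff)
qed

definition jordan_integrable ::
  "(real ^ 'n) set \<Rightarrow> ((real ^ 'n) set \<Rightarrow> real) \<Rightarrow> (real ^ 'n \<Rightarrow> real) \<Rightarrow> bool" where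
  "jordan_integrable \<Omega> \<mu> \<phi> \<longleftrightarrow>
     integrable (upper_measure \<Omega> \<mu>) \<phi> \<and> integrable (upper_measure \<Omega> (\<lambda>B. - \<mu> B)) \<phi>"

text \<open>
  The Jordan parts do not depend linearly on the measure, so linearity of the integral is read
  off from the linear relation that the six Jordan parts satisfy.
\<close>
lemma signed_integral_linear_combination:
  assumes \<mu>: "finite_signed_measure \<Omega> \<mu>" and \<nu>: "finite_signed_measure \<Omega> \<nu>"
    and \<phi>: "jordan_integrable \<Omega> \<mu> \<phi>" "jordan_integrable \<Omega> \<nu> \<phi>"
      "jordan_integrable \<Omega> (\<lambda>A. a * \<mu> A + b * \<nu> A) \<phi>"
  shows "signed_integral \<Omega> (\<lambda>A. a * \<mu> A + b * \<nu> A) \<phi>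
         = a * signed_integral \<Omega> \<mu> \<phi> + b * signed_integral \<Omega> \<nu> \<phi>"
proof -
  let ?\<sigma> = "\<lambda>A. a * \<mu> A + b * \<nu> A"
  have \<sigma>: "finite_signed_measure \<Omega> ?\<sigma>"
    by (rule finite_signed_measure_linear_combination[OF \<mu> \<nu>])
  let ?U = "\<lambda>\<rho>. upper_measure \<Omega> \<rho>" and ?L = "\<lambda>\<rho>. upper_measure \<Omega> (\<lambda>B. - \<rho> B)"
  define P where "P = (!) [?U ?\<sigma>, ?L ?\<sigma>, ?U \<mu>, ?L \<mu>, ?U \<nu>, ?L \<nu>]"
  define c where "c = (!) [1, -1, - a, a, - b, b]"
  have I: "{..<6::nat} = {0,1,2,3,4,5}" by auto
  note fin = \<mu>[THEN finite_upper_measure] \<nu>[THEN finite_upper_measure] \<sigma>[THEN finite_upper_measure]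
    \<mu>[THEN finite_signed_measure_uminus, THEN finite_upper_measure]
    \<nu>[THEN finite_signed_measure_uminus, THEN finite_upper_measure]
    \<sigma>[THEN finite_signed_measure_uminus, THEN finite_upper_measure]
  have "(\<Sum>i<6. c i * integral\<^sup>L (P i) \<phi>) = 0"
  proof (rule integral_linear_relation[where S = "borel_of \<Omega>"])
    show "finite_measure (P i)" if "i \<in> {..<6}" for i
      using that fin unfolding I by (auto simp: P_def)
    show "sets (P i) = sets (borel_of \<Omega>)" if "i \<in> {..<6}" for i
      using that unfolding I by (auto simp: P_def)
    show "integrable (P i) \<phi>" if "i \<in> {..<6}" for i
      using that \<phi> unfolding I jordan_integrable_def by (auto simp: P_def)
    show "\<phi> \<in> borel_measurable (borel_of \<Omega>)"
      using \<phi>(1) borel_measurable_integrable[of "?U \<mu>" \<phi>]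
      unfolding jordan_integrable_def by (auto cong: measurable_cong_sets)
    show "(\<Sum>i<6. c i * measure (P i) A) = 0" if A: "A \<in> sets (borel_of \<Omega>)" for A
    proof -
      have "(\<Sum>i<6. c i * measure (P i) A)
            = (measure (?U ?\<sigma>) A - measure (?L ?\<sigma>) A) - a * (measure (?U \<mu>) A - measure (?L \<mu>) A)
              - b * (measure (?U \<nu>) A - measure (?L \<nu>) A)"
        unfolding I by (simp add: P_def c_def algebra_simps)
      then show ?thesis
        using jordan_decomposition[OF \<sigma> A] jordan_decomposition[OF \<mu> A] jordan_decomposition[OF \<nu> A]
        by simp
    qed
  qed simp
  then show ?thesis
    unfolding I signed_integral_def by (simp add: P_def c_def algebra_simps)
qed

text \<open>
  Any representation of \<open>\<mu>\<close> as a difference of finite measures computes its integral; it need not be the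
  minimal one given by the Jordan parts.
\<close>
lemma signed_integral_difference:
  assumes \<mu>: "finite_signed_measure \<Omega> \<mu>" and \<phi>: "jordan_integrable \<Omega> \<mu> \<phi>"
    and P: "finite_measure P" "sets P = sets (borel_of \<Omega>)" "integrable P \<phi>"
    and N: "finite_measure N" "sets N = sets (borel_of \<Omega>)" "integrable N \<phi>"
    and diff: "\<And>A. A \<in> sets (borel_of \<Omega>) \<Longrightarrow> \<mu> A = measure P A - measure N A"
  shows "signed_integral \<Omega> \<mu> \<phi> = integral\<^sup>L P \<phi> - integral\<^sup>L N \<phi>"
proof -
  let ?U = "upper_measure \<Omega> \<mu>" and ?L = "upper_measure \<Omega> (\<lambda>B. - \<mu> B)"
  define Q where "Q = (!) [?U, ?L, P, N]"
  define c :: "nat \<Rightarrow> real" where "c = (!) [1, -1, -1, 1]"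
  have I: "{..<4::nat} = {0,1,2,3}" by auto
  have "(\<Sum>i<4. c i * integral\<^sup>L (Q i) \<phi>) = 0"
  proof (rule integral_linear_relation[where S = "borel_of \<Omega>"])
    show "finite_measure (Q i)" if "i \<in> {..<4}" for i
      using that finite_upper_measure[OF \<mu>] finite_upper_measure[OF finite_signed_measure_uminus[OF \<mu>]] P(1) N(1)
      unfolding I by (elim insertE emptyE) (simp_all add: Q_def)
    show "sets (Q i) = sets (borel_of \<Omega>)" if "i \<in> {..<4}" for i
      using that unfolding I by (elim insertE emptyE) (simp_all add: Q_def P(2) N(2))
    show "integrable (Q i) \<phi>" if "i \<in> {..<4}" for i
      using that \<phi> P(3) N(3) unfolding I jordan_integrable_def
      by (elim insertE emptyE) (simp_all add: Q_def)
    show "\<phi> \<in> borel_measurable (borel_of \<Omega>)"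
      using P(2,3) borel_measurable_integrable[of P \<phi>] by (auto cong: measurable_cong_sets)
    show "(\<Sum>i<4. c i * measure (Q i) A) = 0" if A: "A \<in> sets (borel_of \<Omega>)" for A
      unfolding I using jordan_decomposition[OF \<mu> A] diff[OF A] by (simp add: Q_def c_def)
  qed simp
  then show ?thesis
    unfolding I signed_integral_def by (simp add: Q_def c_def algebra_simps)
qed

section \<open>Measures with a density\<close>

text \<open>
  The density may be merely Lebesgue measurable, whereas the variations of a signed measure live
  on the Borel sets; pushing forward under the identity restricts the measure to the latter.
\<close>
definition borel_density :: "(real ^ 'n) set \<Rightarrow> (real ^ 'n \<Rightarrow> real) \<Rightarrow> (real ^ 'n) measure" where
  "borel_density \<Omega> g = distr (density (lebesgue_on \<Omega>) (\<lambda>x. ennreal (g x))) (borel_of \<Omega>) (\<lambda>x. x)"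

lemma sets_borel_density [simp]: "sets (borel_density \<Omega> g) = sets (borel_of \<Omega>)"
  unfolding borel_density_def by simp

lemma measurable_id_lebesgue_on_borel_of: "(\<lambda>x. x) \<in> lebesgue_on \<Omega> \<rightarrow>\<^sub>M borel_of \<Omega>"
  using id_borel_measurable_lebesgue_on by (intro measurable_restrict_space2) (auto simp: id_def)

lemma borel_of_sets_lebesgue_on:
  assumes "A \<in> sets (borel_of \<Omega>)"
  shows "A \<in> sets (lebesgue_on \<Omega>)"
  using measurable_sets[OF measurable_id_lebesgue_on_borel_of assms] borel_of_subset[OF assms]
  by (simp add: Int_absorb2)

lemma emeasure_borel_density:
  assumes A: "A \<in> sets (borel_of \<Omega>)" and g: "integrable (lebesgue_on \<Omega>) g" "\<And>x. 0 \<le> g x"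
  shows "emeasure (borel_density \<Omega> g) A = ennreal (LINT x|lebesgue_on \<Omega>. g x * indicator A x)"
proof -
  note A' = borel_of_sets_lebesgue_on[OF A]
  have "emeasure (borel_density \<Omega> g) A = emeasure (density (lebesgue_on \<Omega>) (\<lambda>x. ennreal (g x))) A"
    unfolding borel_density_def using borel_of_subset[OF A] A measurable_id_lebesgue_on_borel_of
    by (subst emeasure_distr) (auto simp: Int_absorb2)
  also have "\<dots> = (\<integral>\<^sup>+x. ennreal (g x) * indicator A x \<partial>lebesgue_on \<Omega>)"
    using A' g by (intro emeasure_density) auto
  also have "\<dots> = (\<integral>\<^sup>+x. ennreal (g x * indicator A x) \<partial>lebesgue_on \<Omega>)"
    by (intro nn_integral_cong) (auto split: split_indicator)
  also have "\<dots> = ennreal (LINT x|lebesgue_on \<Omega>. g x * indicator A x)"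
    using A' g by (intro nn_integral_eq_integral) (auto simp: integrable_real_mult_indicator)
  finally show ?thesis .
qed

lemma measure_borel_density:
  assumes "A \<in> sets (borel_of \<Omega>)" "integrable (lebesgue_on \<Omega>) g" "\<And>x. 0 \<le> g x"
  shows "measure (borel_density \<Omega> g) A = (LINT x|lebesgue_on \<Omega>. g x * indicator A x)"
  using emeasure_borel_density[OF assms] assms(3)
  by (intro measure_eq_emeasure_eq_ennreal integral_nonneg_AE) auto

lemma finite_borel_density:
  assumes "integrable (lebesgue_on \<Omega>) g" "\<And>x. 0 \<le> g x"
  shows "finite_measure (borel_density \<Omega> g)"
  using emeasure_borel_density[OF _ assms, of "space (borel_of \<Omega>)"]
  by (intro finite_measureI) (auto simp: borel_density_def)

lemma
  assumes g: "integrable (lebesgue_on \<Omega>) g" "\<And>x. 0 \<le> g x" and \<phi>: "\<phi> \<in> borel_measurable (borel_of \<Omega>)"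
  shows integrable_borel_density:
      "integrable (borel_density \<Omega> g) \<phi> \<longleftrightarrow> integrable (lebesgue_on \<Omega>) (\<lambda>x. g x * \<phi> x)"
    and integral_borel_density:
      "integral\<^sup>L (borel_density \<Omega> g) \<phi> = (LINT x|lebesgue_on \<Omega>. g x * \<phi> x)"
proof -
  have id: "(\<lambda>x. x) \<in> density (lebesgue_on \<Omega>) (\<lambda>x. ennreal (g x)) \<rightarrow>\<^sub>M borel_of \<Omega>"
    using measurable_id_lebesgue_on_borel_of by simp
  have \<phi>': "\<phi> \<in> borel_measurable (lebesgue_on \<Omega>)"
    using measurable_compose[OF measurable_id_lebesgue_on_borel_of \<phi>] .
  show "integrable (borel_density \<Omega> g) \<phi> \<longleftrightarrow> integrable (lebesgue_on \<Omega>) (\<lambda>x. g x * \<phi> x)"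
    and "integral\<^sup>L (borel_density \<Omega> g) \<phi> = (LINT x|lebesgue_on \<Omega>. g x * \<phi> x)"
    unfolding borel_density_def using g \<phi> \<phi>'
    by (auto simp: integrable_distr_eq[OF id] integral_distr[OF id] integrable_density integral_density)
qed

lemma density_measure_diff:
  assumes \<Omega>: "open \<Omega>" and f: "f \<in> L1 \<Omega>" and A: "A \<in> sets (borel_of \<Omega>)"
  shows "density_measure \<Omega> f A = measure (borel_density \<Omega> (\<lambda>x. max 0 (f x))) A
                                - measure (borel_density \<Omega> (\<lambda>x. max 0 (- f x))) A"
proof -
  let ?leb = "lebesgue_on \<Omega>"
  note A' = borel_of_sets_lebesgue_on[OF A] and sub = borel_of_subset[OF A]
  have int: "integrable ?leb (\<lambda>x. max 0 (f x))" "integrable ?leb (\<lambda>x. max 0 (- f x))"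
    using f by (auto simp: L1_def)
  have "A \<in> sets lebesgue"
    using A' \<Omega> by (simp add: sets_restrict_space_iff)
  have "density_measure \<Omega> f A = (LINT x|lebesgue_on A. f x)"
    using A by (simp add: density_measure_def)
  also have "\<dots> = (LINT x|lebesgue. indicator A x * f x)"
    using \<open>A \<in> sets lebesgue\<close> by (simp add: integral_restrict_space)
  also have "\<dots> = (LINT x|lebesgue. indicator \<Omega> x * (f x * indicator A x))"
    using sub by (intro Bochner_Integration.integral_cong) (auto split: split_indicator)
  also have "\<dots> = (LINT x|?leb. f x * indicator A x)"
    using \<Omega> by (simp add: integral_restrict_space)
  also have "\<dots> = (LINT x|?leb. max 0 (f x) * indicator A x - max 0 (- f x) * indicator A x)"
    by (intro Bochner_Integration.integral_cong) (auto simp: max_def split: split_indicator)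
  also have "\<dots> = (LINT x|?leb. max 0 (f x) * indicator A x) - (LINT x|?leb. max 0 (- f x) * indicator A x)"
    using A' int by (intro Bochner_Integration.integral_diff integrable_real_mult_indicator)
  finally show ?thesis
    using A int by (simp add: measure_borel_density)
qed

lemma finite_signed_measure_density_measure:
  fixes \<Omega> :: "(real ^ 'n) set"
  assumes \<Omega>: "open \<Omega>" and f: "f \<in> L1 \<Omega>"
  shows "finite_signed_measure \<Omega> (density_measure \<Omega> f)"
  unfolding finite_signed_measure_def
proof
  let ?P = "borel_density \<Omega> (\<lambda>x. max 0 (f x))" and ?N = "borel_density \<Omega> (\<lambda>x. max 0 (- f x))"
  interpret P: finite_measure ?P by (rule finite_borel_density) (use f in \<open>auto simp: L1_def\<close>)
  interpret N: finite_measure ?N by (rule finite_borel_density) (use f in \<open>auto simp: L1_def\<close>)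
  note diff = density_measure_diff[OF \<Omega> f]
  show "sigma_additive \<Omega> (density_measure \<Omega> f)"
    unfolding sigma_additive_def
  proof (intro allI impI, elim conjE)
    fix A :: "nat \<Rightarrow> (real ^ 'n) set"
    assume A: "range A \<subseteq> sets (borel_of \<Omega>)" "disjoint_family A"
    have "(\<lambda>i. measure ?P (A i) - measure ?N (A i)) sums (measure ?P (\<Union>i. A i) - measure ?N (\<Union>i. A i))"
      using A by (intro sums_diff P.finite_measure_UNION N.finite_measure_UNION) auto
    moreover have "(\<Union>i. A i) \<in> sets (borel_of \<Omega>)" and "\<And>i. A i \<in> sets (borel_of \<Omega>)"
      using A by auto
    ultimately show "(\<lambda>i. density_measure \<Omega> f (A i)) sums density_measure \<Omega> f (\<Union>i. A i)"
      by (simp add: diff)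
  qed
  have "\<bar>density_measure \<Omega> f B\<bar> \<le> measure ?P (space ?P) + measure ?N (space ?N)"
    if "B \<in> sets (borel_of \<Omega>)" for B
    unfolding diff[OF that] using P.bounded_measure[of B] N.bounded_measure[of B]
      measure_nonneg[of ?P B] measure_nonneg[of ?N B] by linarith
  then show "\<exists>C. \<forall>B\<in>sets (borel_of \<Omega>). \<bar>density_measure \<Omega> f B\<bar> \<le> C" by blast
qed

section \<open>Riesz kernels have uniformly bounded mass\<close>

lemma dyadic_scale:
  fixes r R :: real
  assumes "0 < r" "r \<le> R"
  obtains i where "r \<le> R * (1/2) ^ i" "R * (1/2) ^ Suc i \<le> r"
proof -
  have "\<exists>i. R * (1/2) ^ Suc i \<le> r"
  proof -
    obtain n where "(1/2) ^ n < r / R"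
      using real_arch_pow_inv[of "r / R" "1/2"] assms by auto
    then have "R * (1/2) ^ n < r"
      using assms by (simp add: field_simps)
    moreover have "R * (1/2) ^ Suc n \<le> R * (1/2) ^ n"
      using assms by (intro mult_left_mono power_decreasing) auto
    ultimately show ?thesis by (intro exI[of _ n]) linarith
  qed
  define i where "i = (LEAST i. R * (1/2) ^ Suc i \<le> r)"
  have i: "R * (1/2) ^ Suc i \<le> r"
    unfolding i_def by (rule LeastI_ex) fact
  have "r \<le> R * (1/2) ^ i"
  proof (cases i)
    case (Suc j)
    then have "\<not> R * (1/2) ^ Suc j \<le> r"
      unfolding i_def by (intro not_less_Least) (simp add: i_def)
    with Suc show ?thesis by simp
  qed (use assms in simp)
  with i that show ?thesis by blast
qed

text \<open>
  On the dyadic annulus of radius about \<open>R / 2 ^ i\<close> the kernel is at most \<open>h i\<close>, of order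
  \<open>2 powr (a i)\<close>, while the ball containing the annulus has volume of order \<open>2 powr (- i DIM('a))\<close>. The
  products form a geometric series with ratio \<open>2 powr (a - DIM('a)) < 1\<close>, which does not involve the
  centre \<open>y\<close>.
\<close>
lemma nn_integral_riesz_kernel_bounded:
  fixes a R :: real
  assumes a: "0 \<le> a" "a < real DIM('a)" and R: "0 < R"
  shows "\<exists>M\<ge>0. \<forall>y::'a::euclidean_space.
    (\<integral>\<^sup>+x. indicator (cball y R) x * ennreal (1 / norm (x - y) powr a) \<partial>lborel) \<le> ennreal M"
proof -
  define h :: "nat \<Rightarrow> real" where "h i = (R * (1/2) ^ Suc i) powr (- a)" for i
  define v where "v = unit_ball_vol (real DIM('a))"
  define q where "q = (1/2) powr (real DIM('a) - a)"
  define t where "t i = h i * (v * (R * (1/2) ^ i) ^ DIM('a))" for i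
  have v: "0 \<le> v" by (simp add: v_def)
  have t_eq: "t i = (R / 2) powr (- a) * v * R ^ DIM('a) * q ^ i" for i
  proof -
    have pow: "(1/2::real) ^ i = (1/2) powr real i" by (simp add: powr_realpow)
    have "h i = (R / 2) powr (- a) * ((1/2) ^ i) powr (- a)"
      unfolding h_def using R by (subst powr_mult[symmetric]) (auto simp: mult_ac)
    moreover have "((1/2::real) ^ i) powr (- a) * ((1/2) ^ i) ^ DIM('a) = q ^ i"
    proof -
      have "((1/2::real) ^ i) ^ DIM('a) = ((1/2) ^ i) powr real DIM('a)"
        by (simp add: powr_realpow)
      then have "((1/2::real) ^ i) powr (- a) * ((1/2) ^ i) ^ DIM('a) = ((1/2) ^ i) powr (real DIM('a) - a)"
        by (simp add: powr_add[symmetric])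
      also have "\<dots> = q powr real i"
        unfolding pow q_def by (simp add: powr_powr mult.commute)
      also have "\<dots> = q ^ i"
        by (rule powr_realpow) (simp add: q_def)
      finally show ?thesis .
    qed
    ultimately show ?thesis
      unfolding t_def by (simp add: power_mult_distrib mult_ac)
  qed
  have q: "0 \<le> q" "q < 1"
    unfolding q_def using a powr_less_mono'[of "1/2" 0 "real DIM('a) - a"] by auto
  then have "summable t"
    unfolding t_eq by (intro summable_mult summable_geometric) simp
  have t_nonneg: "0 \<le> t i" for i
    unfolding t_def h_def using R v by auto
  have term_le_suminf: "T i \<le> suminf T" for T :: "nat \<Rightarrow> ennreal" and i
    using sum_le_suminf[of T "{i}"] by simp
  show ?thesis
  proof (intro exI[of _ "suminf t"] conjI allI)
    show "0 \<le> suminf t"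
      by (rule suminf_nonneg[OF \<open>summable t\<close> t_nonneg])
    fix y :: 'a
    have pointwise: "indicator (cball y R) x * ennreal (1 / norm (x - y) powr a)
          \<le> (\<Sum>i. ennreal (h i) * indicator (cball y (R * (1/2) ^ i)) x)" for x
    proof (cases "x \<noteq> y \<and> x \<in> cball y R")
      case True
      define r where "r = norm (x - y)"
      have "0 < r" "r \<le> R"
        using True by (auto simp: r_def dist_norm norm_minus_commute)
      then obtain i where i: "r \<le> R * (1/2) ^ i" "R * (1/2) ^ Suc i \<le> r"
        by (rule dyadic_scale)
      have "1 / r powr a \<le> h i"
        unfolding h_def using i(2) R a(1) \<open>0 < r\<close>
        by (simp add: powr_minus_divide frac_le powr_mono2)
      moreover have "x \<in> cball y (R * (1/2) ^ i)"
        using i(1) by (auto simp: r_def dist_norm norm_minus_commute)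
      ultimately have "indicator (cball y R) x * ennreal (1 / r powr a)
            \<le> ennreal (h i) * indicator (cball y (R * (1/2) ^ i)) x"
        using True by (simp add: ennreal_leI)
      also have "\<dots> \<le> (\<Sum>j. ennreal (h j) * indicator (cball y (R * (1/2) ^ j)) x)"
        using term_le_suminf[of "\<lambda>j. ennreal (h j) * indicator (cball y (R * (1/2) ^ j)) x" i] .
      finally show ?thesis unfolding r_def .
    qed auto
    have "(\<integral>\<^sup>+x. indicator (cball y R) x * ennreal (1 / norm (x - y) powr a) \<partial>lborel)
          \<le> (\<integral>\<^sup>+x. (\<Sum>i. ennreal (h i) * indicator (cball y (R * (1/2) ^ i)) x) \<partial>lborel)"
      by (intro nn_integral_mono pointwise)
    also have "\<dots> = (\<Sum>i. ennreal (h i) * emeasure lborel (cball y (R * (1/2) ^ i)))"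
      by (subst nn_integral_suminf) (auto simp: nn_integral_cmult_indicator
          intro!: borel_measurable_times_ennreal borel_measurable_indicator)
    also have "\<dots> = (\<Sum>i. ennreal (t i))"
      using R v unfolding t_def
      by (intro suminf_cong) (simp add: emeasure_cball v_def[symmetric] ennreal_mult' h_def)
    also have "\<dots> = ennreal (suminf t)"
      by (rule suminf_ennreal2[OF t_nonneg \<open>summable t\<close>])
    finally show "(\<integral>\<^sup>+x. indicator (cball y R) x * ennreal (1 / norm (x - y) powr a) \<partial>lborel)
        \<le> ennreal (suminf t)" .
  qed
qed

lemma model_kernel_le_riesz_kernel:
  fixes x y :: "real ^ 'n"
  assumes "0 \<le> \<gamma>"
  shows "model_kernel \<Omega> s \<gamma> x y \<le> 1 / norm (x - y) powr (real CARD('n) - 2 * s)"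
proof -
  let ?m = "min (bdist \<Omega> x * bdist \<Omega> y / (norm (x - y))\<^sup>2) 1"
  have "0 \<le> ?m" by (simp add: bdist_def infdist_nonneg)
  then have "?m powr \<gamma> \<le> 1" using assms by (intro powr_le1) auto
  then show ?thesis
    unfolding model_kernel_def by (intro mult_right_le_one_le) auto
qed

text \<open>
  The upper bound on \<open>k\<close> holds off the diagonal only, and the diagonal point \<open>x = y\<close> is a null set
  in each of these integrals. The exponent \<open>n - 2 s\<close> lies between \<open>0\<close> and \<open>n\<close> since
  \<open>n \<ge> 3 > 2 s > 0\<close>.
\<close>
lemma green_kernel_mass_bounded:
  fixes \<Omega> :: "(real ^ 'n) set"
  assumes "CARD('n) \<ge> 3" "0 < s" "s \<le> 1" "0 < \<gamma>" "bounded_domain \<Omega>" "green_kernel \<Omega> s \<gamma> k"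
  shows "\<exists>M\<ge>0. \<forall>y\<in>\<Omega>. (\<integral>\<^sup>+x. ennreal (k x y) \<partial>lebesgue_on \<Omega>) \<le> ennreal M"
proof -
  define a where "a = real CARD('n) - 2 * s"
  have op: "open \<Omega>" and bd: "bounded \<Omega>"
    using assms(5) by (auto simp: bounded_domain_def)
  obtain C where C: "0 < C"
    "\<And>x y. x \<in> \<Omega> \<Longrightarrow> y \<in> \<Omega> \<Longrightarrow> x \<noteq> y \<Longrightarrow> k x y \<le> C * model_kernel \<Omega> s \<gamma> x y"
    using assms(6) unfolding green_kernel_def by (metis order_less_le_trans)
  (* every ball of radius R centred in the domain covers the domain *)
  define R where "R = diameter \<Omega> + 1"
  have R: "0 < R" "\<And>x y. x \<in> \<Omega> \<Longrightarrow> y \<in> \<Omega> \<Longrightarrow> dist y x \<le> R"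
    unfolding R_def using diameter_ge_0[OF bd] diameter_bounded_bound[OF bd] by (fastforce simp: dist_commute)+
  have "0 \<le> a" "a < real DIM(real ^ 'n)"
    unfolding a_def using assms by auto
  from nn_integral_riesz_kernel_bounded[OF this R(1)]
  obtain M where M: "M \<ge> 0" "\<And>y::real^'n.
    (\<integral>\<^sup>+x. indicator (cball y R) x * ennreal (1 / norm (x - y) powr a) \<partial>lborel) \<le> ennreal M"
    by blast
  show ?thesis
  proof (intro exI[of _ "C * M"] conjI ballI)
    show "0 \<le> C * M" using C M by simp
    fix y assume y: "y \<in> \<Omega>"
    have "AE x in lebesgue. x \<noteq> y"
      by (rule AE_completion) (rule AE_lborel_singleton)
    then have "AE x in lebesgue. ennreal (k x y) * indicator \<Omega> x
        \<le> ennreal C * (indicator (cball y R) x * ennreal (1 / norm (x - y) powr a))"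
    proof eventually_elim
      fix x assume xy: "x \<noteq> y"
      show "ennreal (k x y) * indicator \<Omega> x
        \<le> ennreal C * (indicator (cball y R) x * ennreal (1 / norm (x - y) powr a))"
      proof (cases "x \<in> \<Omega>")
        case True
        have "k x y \<le> C * model_kernel \<Omega> s \<gamma> x y"
          using C(2) True y xy by blast
        also have "\<dots> \<le> C * (1 / norm (x - y) powr a)"
          unfolding a_def using C(1) assms(4) model_kernel_le_riesz_kernel[of \<gamma> \<Omega> s x y]
          by (intro mult_left_mono) auto
        finally have "ennreal (k x y) \<le> ennreal C * ennreal (1 / norm (x - y) powr a)"
          using C(1) by (simp add: ennreal_mult'[symmetric] ennreal_leI del: times_divide_eq_right mult_1_right)
        then show ?thesis using R(2)[OF True y] True by simp
      qed auto
    qed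
    then have "(\<integral>\<^sup>+x. ennreal (k x y) * indicator \<Omega> x \<partial>lebesgue)
      \<le> (\<integral>\<^sup>+x. ennreal C * (indicator (cball y R) x * ennreal (1 / norm (x - y) powr a)) \<partial>lebesgue)"
      by (rule nn_integral_mono_AE)
    also have "\<dots> = ennreal C * (\<integral>\<^sup>+x. indicator (cball y R) x * ennreal (1 / norm (x - y) powr a) \<partial>lborel)"
      unfolding nn_integral_completion
      by (intro nn_integral_cmult borel_measurable_times_ennreal borel_measurable_indicator) auto
    also have "\<dots> \<le> ennreal (C * M)"
      using C(1) M by (simp add: ennreal_mult' mult_left_mono)
    finally show "(\<integral>\<^sup>+x. ennreal (k x y) \<partial>lebesgue_on \<Omega>) \<le> ennreal (C * M)"
      using op by (simp add: nn_integral_restrict_space)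
  qed
qed

section \<open>Potentials of finite measures\<close>

text \<open>
  The setting of Schur's test: a symmetric nonnegative kernel whose sections have uniformly
  bounded mass.
\<close>
locale potential_kernel =
  fixes \<Omega> :: "(real ^ 'n) set" and k :: "real ^ 'n \<Rightarrow> real ^ 'n \<Rightarrow> real" and M :: real
  assumes open_domain: "open \<Omega>" and bounded_domain: "bounded \<Omega>"
    and kernel_measurable: "(\<lambda>(x, y). k x y) \<in> borel_measurable (restrict_space borel (\<Omega> \<times> \<Omega>))"
    and kernel_nonneg: "x \<in> \<Omega> \<Longrightarrow> y \<in> \<Omega> \<Longrightarrow> 0 \<le> k x y"
    and kernel_sym: "x \<in> \<Omega> \<Longrightarrow> y \<in> \<Omega> \<Longrightarrow> k x y = k y x"
    and mass_nonneg: "0 \<le> M"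
    and kernel_mass: "y \<in> \<Omega> \<Longrightarrow> (\<integral>\<^sup>+x. ennreal (k x y) \<partial>lebesgue_on \<Omega>) \<le> ennreal M"
begin

lemma finite_lebesgue_on: "finite_measure (lebesgue_on \<Omega>)"
  using open_domain bounded_domain by (intro finite_measure_lebesgue_on lmeasurable_open)

lemma kernel_measurable_pair:
  assumes "sets P = sets (borel_of \<Omega>)"
  shows "(\<lambda>(x, y). k x y) \<in> borel_measurable (lebesgue_on \<Omega> \<Otimes>\<^sub>M P)"
proof -
  have space: "space P = \<Omega>"
    using sets_eq_imp_space_eq[OF assms] by (simp add: space_restrict_space)
  have "fst \<in> borel_measurable (lebesgue_on \<Omega> \<Otimes>\<^sub>M P)"
    using measurable_compose[OF measurable_fst id_borel_measurable_lebesgue_on] by (simp add: id_def)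
  moreover have "snd \<in> borel_measurable (lebesgue_on \<Omega> \<Otimes>\<^sub>M P)"
  proof (rule measurable_compose[OF measurable_snd])
    show "(\<lambda>x. x) \<in> borel_measurable P"
      using measurable_restrict_space1[OF measurable_ident, of borel \<Omega>]
      by (simp add: measurable_cong_sets[OF assms refl] id_def)
  qed
  ultimately have "(\<lambda>p. (fst p, snd p)) \<in> lebesgue_on \<Omega> \<Otimes>\<^sub>M P \<rightarrow>\<^sub>M borel"
    by (rule borel_measurable_Pair)
  then have "(\<lambda>p. p) \<in> lebesgue_on \<Omega> \<Otimes>\<^sub>M P \<rightarrow>\<^sub>M borel" by simp
  then have "(\<lambda>p. p) \<in> lebesgue_on \<Omega> \<Otimes>\<^sub>M P \<rightarrow>\<^sub>M restrict_space borel (\<Omega> \<times> \<Omega>)"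
    by (intro measurable_restrict_space2) (auto simp: space_pair_measure space)
  from measurable_compose[OF this kernel_measurable] show ?thesis .
qed

context
  fixes P :: "(real ^ 'n) measure"
  assumes finite_P: "finite_measure P" and sets_P: "sets P = sets (borel_of \<Omega>)"
begin

lemma space_P: "space P = \<Omega>"
  using sets_eq_imp_space_eq[OF sets_P] by (simp add: space_restrict_space)

lemma pair_sigma_finite_lebesgue_on: "pair_sigma_finite (lebesgue_on \<Omega>) P"
proof -
  interpret L: finite_measure "lebesgue_on \<Omega>" by (rule finite_lebesgue_on)
  interpret P: finite_measure P by (rule finite_P)
  show ?thesis ..
qed

lemma nn_integral_kernel_pair_le:
  "(\<integral>\<^sup>+(x, y). ennreal (k x y) \<partial>(lebesgue_on \<Omega> \<Otimes>\<^sub>M P)) \<le> ennreal (M * measure P \<Omega>)"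
proof -
  interpret pair_sigma_finite "lebesgue_on \<Omega>" P by (rule pair_sigma_finite_lebesgue_on)
  interpret P: finite_measure P by (rule finite_P)
  have "(\<lambda>(x, y). ennreal (k x y)) \<in> borel_measurable (lebesgue_on \<Omega> \<Otimes>\<^sub>M P)"
    using kernel_measurable_pair[OF sets_P] by (simp add: case_prod_beta')
  from nn_integral_snd[OF this]
  have "(\<integral>\<^sup>+(x, y). ennreal (k x y) \<partial>(lebesgue_on \<Omega> \<Otimes>\<^sub>M P))
        = (\<integral>\<^sup>+y. (\<integral>\<^sup>+x. ennreal (k x y) \<partial>lebesgue_on \<Omega>) \<partial>P)" by simp
  also have "\<dots> \<le> (\<integral>\<^sup>+y. ennreal M \<partial>P)"
    by (intro nn_integral_mono kernel_mass) (simp add: space_P)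
  also have "\<dots> = ennreal (M * measure P \<Omega>)"
    by (simp add: space_P P.emeasure_eq_measure ennreal_mult mass_nonneg)
  finally show ?thesis .
qed

text \<open>
  This licenses all later exchanges of integrals. The bound on \<open>\<psi>\<close> holds only Lebesgue almost
  everywhere; it transfers to the product because its exceptional set has the form \<open>N \<times> \<Omega>\<close>
  with \<open>N\<close> a Lebesgue null set, whatever the measure \<open>P\<close> is.
\<close>
lemma integrable_weighted_kernel_pair:
  assumes \<psi>: "\<psi> \<in> Linf \<Omega>"
  shows "integrable (lebesgue_on \<Omega> \<Otimes>\<^sub>M P) (\<lambda>(x, y). k x y * \<psi> x)"
proof -
  interpret pair_sigma_finite "lebesgue_on \<Omega>" P by (rule pair_sigma_finite_lebesgue_on)
  obtain C where C: "AE x in lebesgue_on \<Omega>. \<bar>\<psi> x\<bar> \<le> C" and m: "\<psi> \<in> borel_measurable (lebesgue_on \<Omega>)"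
    using \<psi> unfolding Linf_def by auto
  note [measurable] = kernel_measurable_pair[OF sets_P] m
  have [measurable]: "(\<lambda>p. k (fst p) (snd p)) \<in> borel_measurable (lebesgue_on \<Omega> \<Otimes>\<^sub>M P)"
    using kernel_measurable_pair[OF sets_P] by (simp add: case_prod_beta')
  have "integrable (lebesgue_on \<Omega> \<Otimes>\<^sub>M P) (\<lambda>p. \<bar>C\<bar> * k (fst p) (snd p))"
  proof (intro integrable_mult_right integrableI_bounded)
    have "(\<integral>\<^sup>+p. ennreal (norm (k (fst p) (snd p))) \<partial>(lebesgue_on \<Omega> \<Otimes>\<^sub>M P))
          = (\<integral>\<^sup>+(x, y). ennreal (k x y) \<partial>(lebesgue_on \<Omega> \<Otimes>\<^sub>M P))"
      by (intro nn_integral_cong) (auto simp: space_pair_measure space_P kernel_nonneg)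
    also have "\<dots> < \<infinity>"
      using nn_integral_kernel_pair_le by (rule order_le_less_trans) simp
    finally show "(\<integral>\<^sup>+p. ennreal (norm (k (fst p) (snd p))) \<partial>(lebesgue_on \<Omega> \<Otimes>\<^sub>M P)) < \<infinity>" .
  qed measurable
  then show ?thesis
  proof (rule Bochner_Integration.integrable_bound)
    have "AE p in lebesgue_on \<Omega> \<Otimes>\<^sub>M P. \<bar>\<psi> (fst p)\<bar> \<le> C"
    proof (rule AE_pair_measure)
      show "{p \<in> space (lebesgue_on \<Omega> \<Otimes>\<^sub>M P). \<bar>\<psi> (fst p)\<bar> \<le> C} \<in> sets (lebesgue_on \<Omega> \<Otimes>\<^sub>M P)"
        by measurable
      show "AE x in lebesgue_on \<Omega>. AE y in P. \<bar>\<psi> (fst (x, y))\<bar> \<le> C"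
        using C by eventually_elim simp
    qed
    then show "AE p in lebesgue_on \<Omega> \<Otimes>\<^sub>M P.
        norm (case p of (x, y) \<Rightarrow> k x y * \<psi> x) \<le> norm (\<bar>C\<bar> * k (fst p) (snd p))"
    proof eventually_elim
      fix p :: "(real ^ 'n) \<times> (real ^ 'n)" assume "\<bar>\<psi> (fst p)\<bar> \<le> C"
      then have "\<bar>\<psi> (fst p)\<bar> \<le> \<bar>C\<bar>" by linarith
      then show "norm (case p of (x, y) \<Rightarrow> k x y * \<psi> x) \<le> norm (\<bar>C\<bar> * k (fst p) (snd p))"
        by (simp add: case_prod_beta' abs_mult mult.commute[of "k _ _"] mult_right_mono)
    qed
  qed (simp add: case_prod_beta')
qed

lemma one_in_Linf: "(\<lambda>_. 1) \<in> Linf \<Omega>"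
  unfolding Linf_def by auto

lemma AE_integrable_kernel: "AE x in lebesgue_on \<Omega>. integrable P (k x)"
proof -
  interpret pair_sigma_finite "lebesgue_on \<Omega>" P by (rule pair_sigma_finite_lebesgue_on)
  show ?thesis
    using AE_integrable_fst[OF integrable_weighted_kernel_pair[OF one_in_Linf]] by simp
qed

lemma integrable_potential: "integrable (lebesgue_on \<Omega>) (\<lambda>x. integral\<^sup>L P (k x))"
proof -
  interpret pair_sigma_finite "lebesgue_on \<Omega>" P by (rule pair_sigma_finite_lebesgue_on)
  show ?thesis
    using integrable_fst[OF integrable_weighted_kernel_pair[OF one_in_Linf]] by simp
qed

text \<open>
  Symmetry of the kernel enters here: the Green operator integrates over the second argument,
  whereas Fubini's theorem for the potential produces an integral over the first.
\<close>
lemma green_op_eq: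
  "y \<in> \<Omega> \<Longrightarrow> green_op \<Omega> k \<psi> y = (LINT x|lebesgue_on \<Omega>. k x y * \<psi> x)"
  unfolding green_op_def by (intro Bochner_Integration.integral_cong) (auto simp: kernel_sym)

lemma integral_potential_mult:
  assumes "\<psi> \<in> Linf \<Omega>"
  shows "integrable (lebesgue_on \<Omega>) (\<lambda>x. integral\<^sup>L P (k x) * \<psi> x)"
    and "(LINT x|lebesgue_on \<Omega>. integral\<^sup>L P (k x) * \<psi> x) = integral\<^sup>L P (green_op \<Omega> k \<psi>)"
proof -
  interpret pair_sigma_finite "lebesgue_on \<Omega>" P by (rule pair_sigma_finite_lebesgue_on)
  note int = integrable_weighted_kernel_pair[OF assms]
  show "integrable (lebesgue_on \<Omega>) (\<lambda>x. integral\<^sup>L P (k x) * \<psi> x)"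
    using integrable_fst[OF int] by simp
  have "integral\<^sup>L P (green_op \<Omega> k \<psi>) = (LINT y|P. LINT x|lebesgue_on \<Omega>. k x y * \<psi> x)"
    by (intro Bochner_Integration.integral_cong) (auto simp: space_P green_op_eq)
  also have "\<dots> = (LINT x|lebesgue_on \<Omega>. integral\<^sup>L P (k x) * \<psi> x)"
    using Fubini_integral[OF int] by simp
  finally show "(LINT x|lebesgue_on \<Omega>. integral\<^sup>L P (k x) * \<psi> x) = integral\<^sup>L P (green_op \<Omega> k \<psi>)" ..
qed

lemma integral_potential_le:
  "(LINT x|lebesgue_on \<Omega>. integral\<^sup>L P (k x)) \<le> M * measure P \<Omega>"
proof -
  interpret pair_sigma_finite "lebesgue_on \<Omega>" P by (rule pair_sigma_finite_lebesgue_on)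
  have int: "integrable (lebesgue_on \<Omega> \<Otimes>\<^sub>M P) (\<lambda>(x, y). k x y)"
    using integrable_weighted_kernel_pair[OF one_in_Linf] by simp
  have "ennreal (LINT x|lebesgue_on \<Omega>. integral\<^sup>L P (k x))
        = ennreal (integral\<^sup>L (lebesgue_on \<Omega> \<Otimes>\<^sub>M P) (\<lambda>(x, y). k x y))"
    by (simp add: integral_fst[OF int])
  also have "\<dots> = (\<integral>\<^sup>+(x, y). ennreal (k x y) \<partial>(lebesgue_on \<Omega> \<Otimes>\<^sub>M P))"
    using int by (subst nn_integral_eq_integral[symmetric])
      (auto intro!: AE_I2 nn_integral_cong simp: space_pair_measure space_P kernel_nonneg)
  also have "\<dots> \<le> ennreal (M * measure P \<Omega>)"
    by (rule nn_integral_kernel_pair_le)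
  finally show ?thesis
    by (subst (asm) ennreal_le_iff) (auto simp: mass_nonneg)
qed

lemma integral_potential_nonneg: "x \<in> \<Omega> \<Longrightarrow> 0 \<le> integral\<^sup>L P (k x)"
  by (intro integral_nonneg_AE AE_I2) (auto simp: space_P kernel_nonneg)

end

section \<open>The potential operator on signed measures\<close>

definition potential :: "((real ^ 'n) set \<Rightarrow> real) \<Rightarrow> real ^ 'n \<Rightarrow> real" where
  "potential \<mu> x = signed_integral \<Omega> \<mu> (k x)"

context
  fixes \<mu> :: "(real ^ 'n) set \<Rightarrow> real"
  assumes \<mu>: "finite_signed_measure \<Omega> \<mu>"
begin

lemmas upper = finite_upper_measure[OF \<mu>] sets_upper_measure
lemmas lower = finite_upper_measure[OF finite_signed_measure_uminus[OF \<mu>]] sets_upper_measure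

lemma AE_jordan_integrable_kernel: "AE x in lebesgue_on \<Omega>. jordan_integrable \<Omega> \<mu> (k x)"
  using AE_integrable_kernel[OF upper] AE_integrable_kernel[OF lower]
  unfolding jordan_integrable_def by eventually_elim simp

lemma potential_in_L1: "potential \<mu> \<in> L1 \<Omega>"
  unfolding L1_def potential_def signed_integral_def
  using integrable_potential[OF upper] integrable_potential[OF lower] by auto

lemma potential_duality:
  assumes "\<psi> \<in> Linf \<Omega>"
  shows "(LINT x|lebesgue_on \<Omega>. potential \<mu> x * \<psi> x) = signed_integral \<Omega> \<mu> (green_op \<Omega> k \<psi>)"
  unfolding potential_def signed_integral_def left_diff_distrib
  by (subst Bochner_Integration.integral_diff)
     (use integral_potential_mult[OF upper assms] integral_potential_mult[OF lower assms] in auto)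

lemma L1_norm_potential_le:
  "L1_norm \<Omega> (potential \<mu>) \<le> M * enn2real (total_variation \<Omega> \<mu> \<Omega>)"
proof -
  let ?U = "upper_measure \<Omega> \<mu>" and ?L = "upper_measure \<Omega> (\<lambda>B. - \<mu> B)"
  have sa: "sigma_additive \<Omega> \<mu>" "sigma_additive \<Omega> (\<lambda>B. - \<mu> B)"
    using \<mu> finite_signed_measure_uminus[OF \<mu>] unfolding finite_signed_measure_def by auto
  have "L1_norm \<Omega> (potential \<mu>)
        \<le> (LINT x|lebesgue_on \<Omega>. integral\<^sup>L ?U (k x) + integral\<^sup>L ?L (k x))"
    unfolding L1_norm_def
  proof (rule integral_mono)
    show "integrable (lebesgue_on \<Omega>) (\<lambda>x. \<bar>potential \<mu> x\<bar>)"
      using potential_in_L1 by (simp add: L1_def)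
    show "integrable (lebesgue_on \<Omega>) (\<lambda>x. integral\<^sup>L ?U (k x) + integral\<^sup>L ?L (k x))"
      using integrable_potential[OF upper] integrable_potential[OF lower] by auto
    show "\<bar>potential \<mu> x\<bar> \<le> integral\<^sup>L ?U (k x) + integral\<^sup>L ?L (k x)"
      if "x \<in> space (lebesgue_on \<Omega>)" for x
      using that integral_potential_nonneg[OF upper, of x] integral_potential_nonneg[OF lower, of x]
      unfolding potential_def signed_integral_def by (auto simp: abs_le_iff)
  qed
  also have "\<dots> = (LINT x|lebesgue_on \<Omega>. integral\<^sup>L ?U (k x)) + (LINT x|lebesgue_on \<Omega>. integral\<^sup>L ?L (k x))"
    using integrable_potential[OF upper] integrable_potential[OF lower] by simp
  also have "\<dots> \<le> M * measure ?U \<Omega> + M * measure ?L \<Omega>"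
    by (intro add_mono integral_potential_le[OF upper] integral_potential_le[OF lower])
  also have "\<dots> = M * enn2real (emeasure ?U \<Omega> + emeasure ?L \<Omega>)"
    using upper(1) lower(1) 
    by (simp add: finite_measure.emeasure_eq_measure ennreal_plus[symmetric] distrib_left del: ennreal_plus)
  also have "\<dots> = M * enn2real (total_variation \<Omega> \<mu> \<Omega>)"
    by (simp add: total_variation_def emeasure_upper_measure sa domain_in_borel_of)
  finally show ?thesis .
qed

end

lemma potential_linear_combination:
  assumes \<mu>: "finite_signed_measure \<Omega> \<mu>" and \<nu>: "finite_signed_measure \<Omega> \<nu>"
  shows "AE x in lebesgue_on \<Omega>.
    potential (\<lambda>A. a * \<mu> A + b * \<nu> A) x = a * potential \<mu> x + b * potential \<nu> x"
  using AE_jordan_integrable_kernel[OF \<mu>] AE_jordan_integrable_kernel[OF \<nu>]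
    AE_jordan_integrable_kernel[OF finite_signed_measure_linear_combination[OF \<mu> \<nu>, of a b]]
  unfolding potential_def
  by eventually_elim (rule signed_integral_linear_combination[OF \<mu> \<nu>])

text \<open>
  Linearity reduces the difference of potentials to the potential of \<open>\<nu> - \<mu>\<close>, up to a null set.
\<close>
lemma L1_norm_potential_diff_le:
  assumes \<mu>: "finite_signed_measure \<Omega> \<mu>" and \<nu>: "finite_signed_measure \<Omega> \<nu>"
  shows "L1_norm \<Omega> (\<lambda>x. potential \<nu> x - potential \<mu> x)
         \<le> M * enn2real (total_variation \<Omega> (\<lambda>A. \<nu> A - \<mu> A) \<Omega>)"
proof -
  have fs: "finite_signed_measure \<Omega> (\<lambda>A. \<nu> A - \<mu> A)"
    using finite_signed_measure_linear_combination[OF \<nu> \<mu>, of 1 "-1"] by simp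
  have "L1_norm \<Omega> (\<lambda>x. potential \<nu> x - potential \<mu> x) = L1_norm \<Omega> (potential (\<lambda>A. \<nu> A - \<mu> A))"
    unfolding L1_norm_def
  proof (rule integral_cong_AE)
    show "AE x in lebesgue_on \<Omega>. \<bar>potential \<nu> x - potential \<mu> x\<bar> = \<bar>potential (\<lambda>A. \<nu> A - \<mu> A) x\<bar>"
      using potential_linear_combination[OF \<nu> \<mu>, of 1 "-1"] by eventually_elim simp
  qed (use potential_in_L1[OF \<mu>] potential_in_L1[OF \<nu>] potential_in_L1[OF fs] in
        \<open>auto simp: L1_def dest!: borel_measurable_integrable\<close>)
  with L1_norm_potential_le[OF fs] show ?thesis by simp
qed

text \<open>
  For almost every point the kernel section is integrable against both Jordan parts and against
  the positive and negative parts of the density; the signed integral may then be computed from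
  the latter pair.
\<close>
lemma potential_density_measure:
  assumes f: "f \<in> L1 \<Omega>"
  shows "AE x in lebesgue_on \<Omega>. potential (density_measure \<Omega> f) x = green_op \<Omega> k f x"
proof -
  let ?leb = "lebesgue_on \<Omega>" and ?p = "\<lambda>x. max 0 (f x)" and ?n = "\<lambda>x. max 0 (- f x)"
  have int: "integrable ?leb ?p" "integrable ?leb ?n"
    using f by (auto simp: L1_def)
  note fs = finite_signed_measure_density_measure[OF open_domain f]
  have fin: "finite_measure (borel_density \<Omega> ?p)" "finite_measure (borel_density \<Omega> ?n)"
    using int by (auto intro!: finite_borel_density)
  show ?thesis
    using AE_jordan_integrable_kernel[OF fs] AE_integrable_kernel[OF fin(1) sets_borel_density]
      AE_integrable_kernel[OF fin(2) sets_borel_density]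
  proof eventually_elim
    fix x
    assume x: "jordan_integrable \<Omega> (density_measure \<Omega> f) (k x)"
      "integrable (borel_density \<Omega> ?p) (k x)" "integrable (borel_density \<Omega> ?n) (k x)"
    have kx: "k x \<in> borel_measurable (borel_of \<Omega>)"
      using borel_measurable_integrable[OF x(2)] by (simp cong: measurable_cong_sets)
    have "potential (density_measure \<Omega> f) x
          = integral\<^sup>L (borel_density \<Omega> ?p) (k x) - integral\<^sup>L (borel_density \<Omega> ?n) (k x)"
      unfolding potential_def using density_measure_diff[OF open_domain f]
      by (intro signed_integral_difference[OF fs x(1)] fin sets_borel_density x(2,3))
    also have "\<dots> = (LINT y|?leb. ?p y * k x y - ?n y * k x y)"
      using x int kx by (simp add: integrable_borel_density integral_borel_density)
    also have "\<dots> = green_op \<Omega> k f x"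
      unfolding green_op_def
      by (intro Bochner_Integration.integral_cong) (auto simp: max_def)
    finally show "potential (density_measure \<Omega> f) x = green_op \<Omega> k f x" .
  qed
qed

lemma continuous_on_measures_potential: "continuous_on_measures \<Omega> potential"
  unfolding continuous_on_measures_def
proof (intro ballI allI impI)
  fix \<mu> and e :: real assume \<mu>: "\<mu> \<in> radon_measures \<Omega>" and e: "0 < e"
  show "\<exists>d>0. \<forall>\<nu>\<in>radon_measures \<Omega>. total_variation \<Omega> (\<lambda>A. \<nu> A - \<mu> A) \<Omega> < ennreal d \<longrightarrow>
      L1_norm \<Omega> (\<lambda>x. potential \<nu> x - potential \<mu> x) < e"
    (* M + 1 instead of M, since M may be zero *)
  proof (intro exI[of _ "e / (M + 1)"] conjI ballI impI)
    show "0 < e / (M + 1)" using e mass_nonneg by simp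
    fix \<nu> assume \<nu>: "\<nu> \<in> radon_measures \<Omega>"
      and tv: "total_variation \<Omega> (\<lambda>A. \<nu> A - \<mu> A) \<Omega> < ennreal (e / (M + 1))"
    let ?t = "enn2real (total_variation \<Omega> (\<lambda>A. \<nu> A - \<mu> A) \<Omega>)"
    have "?t < e / (M + 1)"
      using tv e mass_nonneg by (subst enn2real_less_iff) (auto simp: less_top[symmetric])
    then have "(M + 1) * ?t < e"
      using mass_nonneg by (simp add: field_simps)
    moreover have "M * ?t \<le> (M + 1) * ?t"
      by (intro mult_right_mono) auto
    ultimately show "L1_norm \<Omega> (\<lambda>x. potential \<nu> x - potential \<mu> x) < e"
      using L1_norm_potential_diff_le[OF \<mu>[THEN radon_measures_finite_signed_measure]
          \<nu>[THEN radon_measures_finite_signed_measure]] by linarith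
  qed
qed

lemma continuous_linear_extension_potential: "continuous_linear_extension \<Omega> k potential"
  unfolding continuous_linear_extension_def maps_into_L1_def extends_green_op_def linear_on_measures_def
  by (intro conjI ballI allI continuous_on_measures_potential potential_in_L1 potential_density_measure
      potential_linear_combination radon_measures_finite_signed_measure)

lemma self_adjoint_extension_potential: "self_adjoint_extension \<Omega> k potential"
  unfolding self_adjoint_extension_def
  by (intro ballI potential_duality radon_measures_finite_signed_measure)

end

section \<open>Uniqueness of weak dual solutions\<close>

text \<open>
  The test function \<open>sgn (u - v)\<close> restricted to a compact set \<open>K\<close> turns the hypothesis into
  \<open>\<integral>\<^sub>K \<bar>u - v\<bar> = 0\<close>, and an open set is a countable union of compact subsets.
\<close>
lemma AE_eq_if_integrals_against_Linf_c_eq: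
  fixes \<Omega> :: "(real ^ 'n) set"
  assumes op: "open \<Omega>" and u: "u \<in> L1 \<Omega>" and v: "v \<in> L1 \<Omega>"
    and eq: "\<And>\<psi>. \<psi> \<in> Linf_c \<Omega> \<Longrightarrow>
      (LINT x|lebesgue_on \<Omega>. u x * \<psi> x) = (LINT x|lebesgue_on \<Omega>. v x * \<psi> x)"
  shows "AE x in lebesgue_on \<Omega>. u x = v x"
proof -
  let ?leb = "lebesgue_on \<Omega>"
  have int: "integrable ?leb u" "integrable ?leb v"
    using u v by (auto simp: L1_def)
  have on_compact: "AE x in ?leb. x \<in> K \<longrightarrow> u x = v x" if K: "compact K" "K \<subseteq> \<Omega>" for K
  proof -
    define \<psi> where "\<psi> x = sgn (u x - v x) * indicator K x" for x
    have "K \<in> sets ?leb"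
      using K op by (auto simp: sets_restrict_space_iff compact_imp_closed)
    then have meas: "\<psi> \<in> borel_measurable ?leb"
      unfolding \<psi>_def using int by (auto intro!: borel_measurable_times borel_measurable_sgn)
    have bound: "\<bar>\<psi> x\<bar> \<le> 1" for x
      unfolding \<psi>_def by (auto simp: abs_mult sgn_if split: split_indicator)
    have \<psi>: "\<psi> \<in> Linf_c \<Omega>"
      unfolding Linf_c_def Linf_def using meas bound K
      by (auto intro!: exI[of _ 1] exI[of _ K] simp: \<psi>_def)
    have int\<psi>: "integrable ?leb (\<lambda>x. w x * \<psi> x)" if w: "integrable ?leb w" for w
      using w
    proof (rule Bochner_Integration.integrable_bound)
      show "AE x in ?leb. norm (w x * \<psi> x) \<le> norm (w x)"
        using bound by (auto simp: abs_mult intro!: mult_left_le)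
    qed (use meas w in auto)
    have "(LINT x|?leb. u x * \<psi> x - v x * \<psi> x) = 0"
      using int\<psi>[OF int(1)] int\<psi>[OF int(2)] eq[OF \<psi>] by simp
    moreover have pos: "u x * \<psi> x - v x * \<psi> x = \<bar>u x - v x\<bar> * indicator K x" for x
      unfolding \<psi>_def by (auto simp: abs_sgn[of "u x - v x"] algebra_simps)
    moreover have "integrable ?leb (\<lambda>x. u x * \<psi> x - v x * \<psi> x)"
      using int\<psi>[OF int(1)] int\<psi>[OF int(2)] by simp
    ultimately have "AE x in ?leb. \<bar>u x - v x\<bar> * indicator K x = 0"
      by (subst (asm) integral_nonneg_eq_0_iff_AE) (auto simp: pos)
    then show ?thesis by eventually_elim auto
  qed
  obtain C :: "nat \<Rightarrow> (real ^ 'n) set" where C: "\<And>i. compact (C i)" "\<And>i. C i \<subseteq> \<Omega>" "(\<Union>i. C i) = \<Omega>"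
    using open_Union_compact_subsets[OF op] by metis
  have "AE x in ?leb. \<forall>i. x \<in> C i \<longrightarrow> u x = v x"
    unfolding AE_all_countable using on_compact C by blast
  moreover have "AE x in ?leb. x \<in> \<Omega>"
    by (rule AE_I2) simp
  ultimately show ?thesis
  proof eventually_elim
    case (elim x)
    then show ?case using C(3) by blast
  qed
qed

lemma weak_dual_solution_unique:
  assumes "open \<Omega>" "weak_dual_solution \<Omega> k \<mu> u" "weak_dual_solution \<Omega> k \<mu> v"
  shows "AE x in lebesgue_on \<Omega>. u x = v x"
  using assms unfolding weak_dual_solution_def
  by (intro AE_eq_if_integrals_against_Linf_c_eq) auto

lemma weak_dual_solution_self_adjoint_extension:
  assumes "continuous_linear_extension \<Omega> k T" "self_adjoint_extension \<Omega> k T" "\<mu> \<in> radon_measures \<Omega>"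
  shows "weak_dual_solution \<Omega> k \<mu> (T \<mu>)"
  using assms
  unfolding weak_dual_solution_def continuous_linear_extension_def maps_into_L1_def
    self_adjoint_extension_def Linf_c_def by auto

theorem theorem2p4:
  fixes \<Omega> :: "(real ^ 'n) set"
    and s \<gamma> :: real
    and k :: "real ^ 'n \<Rightarrow> real ^ 'n \<Rightarrow> real"
  assumes "CARD('n) \<ge> 3"
    and "0 < s" "s \<le> 1"
    and "0 < \<gamma>" "\<gamma> \<le> 1"
    and "bounded_domain \<Omega>"
    and "green_kernel \<Omega> s \<gamma> k"
    and "green_self_adjoint \<Omega> k"
    and "green_regularizing \<Omega> k"
  shows "\<exists>T. continuous_linear_extension \<Omega> k T \<and>
             self_adjoint_extension \<Omega> k T \<and>
             (\<forall>T'. continuous_linear_extension \<Omega> k T' \<and> self_adjoint_extension \<Omega> k T' \<longrightarrow>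
                (\<forall>\<mu>\<in>radon_measures \<Omega>. AE x in lebesgue_on \<Omega>. T' \<mu> x = T \<mu> x)) \<and>
             (\<forall>\<mu>\<in>radon_measures \<Omega>.
                weak_dual_solution \<Omega> k \<mu> (T \<mu>) \<and>
                (\<forall>u. weak_dual_solution \<Omega> k \<mu> u \<longrightarrow> (AE x in lebesgue_on \<Omega>. u x = T \<mu> x)))"
proof -
  have op: "open \<Omega>" using assms(6) by (simp add: bounded_domain_def)
  obtain M where "M \<ge> 0" "\<And>y. y \<in> \<Omega> \<Longrightarrow> (\<integral>\<^sup>+x. ennreal (k x y) \<partial>lebesgue_on \<Omega>) \<le> ennreal M"
    using green_kernel_mass_bounded[OF assms(1-4,6,7)] by blast
  then interpret potential_kernel \<Omega> k M
    using assms(6,7) by unfold_locales (auto simp: bounded_domain_def green_kernel_def)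
  have solution: "weak_dual_solution \<Omega> k \<mu> (potential \<mu>)" if "\<mu> \<in> radon_measures \<Omega>" for \<mu>
    using weak_dual_solution_self_adjoint_extension[OF continuous_linear_extension_potential
        self_adjoint_extension_potential that] .
  show ?thesis
    using continuous_linear_extension_potential self_adjoint_extension_potential solution
      weak_dual_solution_unique[OF op] weak_dual_solution_self_adjoint_extension
    by (intro exI[of _ potential] conjI allI impI ballI) blast+
qed

end
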